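(* Let $\{x^k\}_{k\ge0}$ be an infinite sequence generated by the regularized proximal Newton method (described in the context), with $r(x^k)\ne0$ for all $k$, and let $\mathcal K$ be the (infinite) set of iteration indices defined in the context. Suppose: (a) the set $X^*$ of strongly stationary points is nonempty and there exists an accumulation point $x^*\in X^*$ of the subsequence $\{x^k\}_{k\in\mathcal K}$; (b) there exist $\varepsilon>0$ and $L_\psi>0$ such that $\|\nabla^2\psi(Ax-b)-\nabla^2\psi(Ay-b)\|\le L_\psi\|Ax-Ay\|$ for all $x,y\in B_\varepsilon(x^* )\cap\operatorname{dom}\varphi$; (c) there exist $\beta>0$ and $q>\max\{\delta,1-\delta\}$ such that $\beta\operatorname{dist}(x,X^* )\le\|r(x)\|^q$ for all $x\in B_\varepsilon(x^* )\cap\operatorname{dom}\varphi$ (with $\delta$ the parameter of the algorithm and the same $\varepsilon$ as in (b)). Then $\{x^k\}$ converges to $x^*$, and $\{\|r(x^k)\|\}$ converges to $0$ at the rate of $\rho:=\min\{1+\tau,\delta+q\}>1$.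
   Context: Setting. Let $A\in\mathbb{R}^{m\times n}$, $b\in\mathbb{R}^m$, and let $\psi:\mathbb{R}^m\to\mathbb{R}\cup\{\infty\}$, $\varphi:\mathbb{R}^n\to\mathbb{R}\cup\{\infty\}$ be proper lower semicontinuous. Put $f(x)=\psi(Ax-b)$, $F=f+\varphi$. Standing assumptions: (i) there is a closed set $\Omega\subseteq\mathbb{R}^n$ with $\operatorname{dom}\varphi\subseteq\Omega$ such that $\psi$ is twice continuously differentiable on an open set containing $\{Ax-b: x\in\Omega\}$; (ii) $\varphi$ is convex and continuous on (relative to) $\operatorname{dom}\varphi$; (iii) $\inf F>-\infty$. Thus $\nabla f(x)=A^\top\nabla\psi(Ax-b)$, $\nabla^2f(x)=A^\top\nabla^2\psi(Ax-b)A$ for $x\in\Omega$. $\|\cdot\|$ is the Euclidean norm for vectors and the spectral norm for matrices, $\lambda_{\min}$ is the smallest eigenvalue, $t_+=\max(0,t)$, $B_\varepsilon(x)$ is the closed Euclidean ball, $\operatorname{dist}$ is Euclidean distance, $\operatorname{prox}_\varphi(x)=\operatorname{argmin}_y\{\varphi(y)+\frac12\|y-x\|^2\}$. The residual is $r(x)=x-\operatorname{prox}_\varphi(x-\nabla f(x))$; $x\in\operatorname{dom}\varphi$ is stationary, i.e. $0\in\nabla f(x)+\partial\varphi(x)$, iff $r(x)=0$. A stationary point $x$ is strongly stationary if in addition $\nabla^2\psi(Ax-b)\succeq0$; $X^*$ is the set of strongly stationary points. Algorithm (regularized proximal Newton method). Choose $x^0\in\operatorname{dom}\varphi$, $0<c_1<c_2<1$,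 $\sigma_1\in(0,1)$, $\sigma_2>1$, $\eta,\theta,\alpha\in(0,1)$, $a\ge1$, $0<\nu_{\min}\le\nu_0\le\overline\nu$, $0<\delta\le1$, $\tau\ge\delta$, $p_{\min}\in(0,1/2)$, $\kappa>1+\delta$. Set $\overline r_0=\|r(x^0)\|$, $\mu_0=\nu_0\overline r_0^{\,\delta}$. For $k=0,1,2,\dots$: Let $\Lambda_k=a[-\lambda_{\min}(\nabla^2\psi(Ax^k-b))]_+$, $H_k=\nabla^2f(x^k)+\Lambda_kA^\top A$ (positive semidefinite), $G_k=H_k+\mu_kI$, $q_k(x)=f(x^k)+\nabla f(x^k)^\top(x-x^k)+\frac12(x-x^k)^\top\nabla^2f(x^k)(x-x^k)+\varphi(x)$, $\hat q_k(x)=f(x^k)+\nabla f(x^k)^\top(x-x^k)+\frac12(x-x^k)^\top G_k(x-x^k)+\varphi(x)$, $R_k(x)=x-\operatorname{prox}_\varphi(x-\nabla f(x^k)-G_k(x-x^k))$. Step 1: compute an inexact minimizer $\hat x^k$ of $\hat q_k$, i.e. any point with $\|R_k(\hat x^k)\|\le\theta\min\{\|r(x^k)\|,\|r(x^k)\|^{1+\tau}\}$ and $F(x^k)-\hat q_k(\hat x^k)\ge\frac{\alpha\mu_k}{2}\|\hat x^k-x^k\|^2$. Step 2: set $d^k=\hat x^k-x^k$, $\mathrm{pred}_k=F(x^k)-q_k(\hat x^k)$, $\mathrm{ared}_k=F(x^k)-F(\hat x^k)$, $\rho_k=\mathrm{ared}_k/\mathrm{pred}_k$. Step 3: if $\mathrm{pred}_k\le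 p_{\min}(1-\theta)\|d^k\|\min\{\|r(x^k)\|,\|r(x^k)\|^\kappa\}$ or $\rho_k\le c_1$, set $x^{k+1}=x^k$, $\nu_{k+1}=\sigma_2\nu_k$ (unsuccessful iteration). Otherwise set $x^{k+1}=\hat x^k$ and: if $\rho_k\le c_2$, $\nu_{k+1}=\min\{\nu_k,\overline\nu\}$ (successful iteration); if $\rho_k>c_2$, $\nu_{k+1}=\min\{\max\{\sigma_1\nu_k,\nu_{\min}\},\overline\nu\}$ (highly successful iteration). Step 4: if $\|r(x^{k+1})\|\le\eta\overline r_k$, set $\overline r_{k+1}=\|r(x^{k+1})\|$; otherwise $\overline r_{k+1}=\overline r_k$. Set $\mu_{k+1}=\nu_{k+1}\overline r_{k+1}^{\,\delta}$. $\mathcal K=\{0\}\cup\{k\in\mathbb{N}:\ \|r(x^k)\|\le\eta\overline r_{k-1}\}$ (the indices $k$ for which the if-condition of Step 4 held in iteration $k-1$); this set is infinite. A nonnegative sequence $\{t_k\}$ converges to $0$ at the rate of $\rho>1$ if $t_k\to0$ and there is $C>0$ with $t_{k+1}\le Ct_k^{\rho}$ for all sufficiently large $k$. *)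

theory Defs
  imports "HOL-Analysis.Analysis"
begin

section \<open>Matrices, gradients and Hessians\<close>

definition spectral_norm :: "real ^ 'n ^ 'm \<Rightarrow> real" where
  "spectral_norm M = onorm (\<lambda>v. M *v v)"

definition real_eigenvalue :: "real ^ 'n ^ 'n \<Rightarrow> real \<Rightarrow> bool" where
  "real_eigenvalue M l \<longleftrightarrow> (\<exists>v. v \<noteq> 0 \<and> M *v v = l *\<^sub>R v)"

definition lambda_min :: "real ^ 'n ^ 'n \<Rightarrow> real" where
  "lambda_min M = (LEAST l. real_eigenvalue M l)"

text \<open>Symmetry is not part of the following predicate; it is only applied to Hessians of
  twice continuously differentiable functions.\<close>

definition psd :: "real ^ 'n ^ 'n \<Rightarrow> bool" where
  "psd M \<longleftrightarrow> (\<forall>v. 0 \<le> v \<bullet> (M *v v))"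

definition gradient :: "(real ^ 'n \<Rightarrow> real) \<Rightarrow> real ^ 'n \<Rightarrow> real ^ 'n" where
  "gradient g x = (THE D. GDERIV g x :> D)"

definition hessian :: "(real ^ 'n \<Rightarrow> real) \<Rightarrow> real ^ 'n \<Rightarrow> real ^ 'n ^ 'n" where
  "hessian g x = jacobian (gradient g) (at x)"

definition C2_on :: "(real ^ 'n) set \<Rightarrow> (real ^ 'n \<Rightarrow> real) \<Rightarrow> bool" where
  "C2_on U g \<longleftrightarrow> open U \<and> g differentiable_on U \<and> gradient g differentiable_on U
     \<and> continuous_on U (hessian g)"

section \<open>Extended-valued functions\<close>

definition effdom :: "('a \<Rightarrow> ereal) \<Rightarrow> 'a set" where
  "effdom g = {x. g x < \<infinity>}"

definition proper :: "('a \<Rightarrow> ereal) \<Rightarrow> bool" where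
  "proper g \<longleftrightarrow> (\<forall>x. g x \<noteq> -\<infinity>) \<and> effdom g \<noteq> {}"

definition lsc :: "('a::topological_space \<Rightarrow> ereal) \<Rightarrow> bool" where
  "lsc g \<longleftrightarrow> (\<forall>x. g x \<le> Liminf (at x) g)"

definition convex_ereal :: "('a::real_vector \<Rightarrow> ereal) \<Rightarrow> bool" where
  "convex_ereal g \<longleftrightarrow> (\<forall>x y t. 0 < t \<and> t < 1 \<longrightarrow>
     g ((1 - t) *\<^sub>R x + t *\<^sub>R y) \<le> ereal (1 - t) * g x + ereal t * g y)"

definition subdifferential :: "('a::real_inner \<Rightarrow> ereal) \<Rightarrow> 'a \<Rightarrow> 'a set" where
  "subdifferential g x = {v. x \<in> effdom g \<and> (\<forall>y. g x + ereal (v \<bullet> (y - x)) \<le> g y)}"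

definition prox :: "('a::real_normed_vector \<Rightarrow> ereal) \<Rightarrow> 'a \<Rightarrow> 'a" where
  "prox g x = (ARG_MIN (\<lambda>y. g y + ereal ((norm (y - x))\<^sup>2 / 2)) y. True)"

section \<open>The composite problem\<close>

locale composite_data =
  fixes A :: "real ^ 'n ^ 'm" and b :: "real ^ 'm"
    and \<psi> :: "real ^ 'm \<Rightarrow> ereal" and \<phi> :: "real ^ 'n \<Rightarrow> ereal"
begin

definition smooth_part :: "real ^ 'n \<Rightarrow> ereal" where
  "smooth_part x = \<psi> (A *v x - b)"

definition objective :: "real ^ 'n \<Rightarrow> ereal" where
  "objective x = smooth_part x + \<phi> x"

definition grad_f :: "real ^ 'n \<Rightarrow> real ^ 'n" where
  "grad_f x = gradient (\<lambda>y. real_of_ereal (smooth_part y)) x"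

definition hess_f :: "real ^ 'n \<Rightarrow> real ^ 'n ^ 'n" where
  "hess_f x = hessian (\<lambda>y. real_of_ereal (smooth_part y)) x"

text \<open>The Hessian of \<open>\<psi>\<close> evaluated at \<open>A x - b\<close>.\<close>

definition hess_psi_at :: "real ^ 'n \<Rightarrow> real ^ 'm ^ 'm" where
  "hess_psi_at x = hessian (\<lambda>z. real_of_ereal (\<psi> z)) (A *v x - b)"

definition residual :: "real ^ 'n \<Rightarrow> real ^ 'n" where
  "residual x = x - prox \<phi> (x - grad_f x)"

definition stationary :: "real ^ 'n \<Rightarrow> bool" where
  "stationary x \<longleftrightarrow> x \<in> effdom \<phi> \<and> 0 \<in> (\<lambda>v. grad_f x + v) ` subdifferential \<phi> x"

definition strongly_stationary_points :: "(real ^ 'n) set" where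
  "strongly_stationary_points = {x. stationary x \<and> psd (hess_psi_at x)}"

text \<open>The model at \<open>z\<close> with second-order term given by the matrix \<open>M\<close>, as a function of \<open>y\<close>,
  and the proximal residual of that model.\<close>

definition model :: "real ^ 'n ^ 'n \<Rightarrow> real ^ 'n \<Rightarrow> real ^ 'n \<Rightarrow> ereal" where
  "model M z y = smooth_part z
     + ereal (grad_f z \<bullet> (y - z) + (y - z) \<bullet> (M *v (y - z)) / 2) + \<phi> y"

definition model_residual :: "real ^ 'n ^ 'n \<Rightarrow> real ^ 'n \<Rightarrow> real ^ 'n \<Rightarrow> real ^ 'n" where
  "model_residual M z y = y - prox \<phi> (y - grad_f z - M *v (y - z))"

end

locale composite_problem = composite_data A b \<psi> \<phi>
  for A :: "real ^ 'n ^ 'm" and b :: "real ^ 'm"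
    and \<psi> :: "real ^ 'm \<Rightarrow> ereal" and \<phi> :: "real ^ 'n \<Rightarrow> ereal" +
  assumes proper_psi: "proper \<psi>" and lsc_psi: "lsc \<psi>"
    and proper_phi: "proper \<phi>" and lsc_phi: "lsc \<phi>"
    and smoothness: "\<exists>\<Omega> U. closed \<Omega> \<and> effdom \<phi> \<subseteq> \<Omega> \<and> (\<lambda>x. A *v x - b) ` \<Omega> \<subseteq> U
          \<and> (\<forall>z\<in>U. \<psi> z < \<infinity>) \<and> C2_on U (\<lambda>z. real_of_ereal (\<psi> z))"
    and convex_phi: "convex_ereal \<phi>"
    and continuous_phi: "continuous_on (effdom \<phi>) \<phi>"
    and bounded_below: "(INF x. objective x) > -\<infinity>"

section \<open>The regularized proximal Newton method\<close>

text \<open>\<open>x\<close>, \<open>xhat\<close>, \<open>\<nu>\<close> and \<open>rbar\<close> are the sequences produced by the method; \<open>\<nu> 0\<close> is the chosen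
  initial regularization parameter.\<close>

locale rpn_data = composite_data A b \<psi> \<phi>
  for A :: "real ^ 'n ^ 'm" and b :: "real ^ 'm"
    and \<psi> :: "real ^ 'm \<Rightarrow> ereal" and \<phi> :: "real ^ 'n \<Rightarrow> ereal" +
  fixes c\<^sub>1 c\<^sub>2 \<sigma>\<^sub>1 \<sigma>\<^sub>2 \<eta> \<theta> \<alpha> a \<nu>min \<nu>max \<delta> \<tau> pmin \<kappa> :: real
    and x xhat :: "nat \<Rightarrow> real ^ 'n" and \<nu> rbar :: "nat \<Rightarrow> real"
begin

definition mu :: "nat \<Rightarrow> real" where
  "mu k = \<nu> k * rbar k powr \<delta>"

definition Lambda :: "nat \<Rightarrow> real" where
  "Lambda k = a * max 0 (- lambda_min (hess_psi_at (x k)))"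

definition H :: "nat \<Rightarrow> real ^ 'n ^ 'n" where
  "H k = hess_f (x k) + Lambda k *\<^sub>R (transpose A ** A)"

definition G :: "nat \<Rightarrow> real ^ 'n ^ 'n" where
  "G k = H k + mu k *\<^sub>R mat 1"

definition q :: "nat \<Rightarrow> real ^ 'n \<Rightarrow> ereal" where
  "q k = model (hess_f (x k)) (x k)"

definition qhat :: "nat \<Rightarrow> real ^ 'n \<Rightarrow> ereal" where
  "qhat k = model (G k) (x k)"

definition R :: "nat \<Rightarrow> real ^ 'n \<Rightarrow> real ^ 'n" where
  "R k = model_residual (G k) (x k)"

definition r :: "nat \<Rightarrow> real" where
  "r k = norm (residual (x k))"

definition d :: "nat \<Rightarrow> real ^ 'n" where
  "d k = xhat k - x k"

definition pred :: "nat \<Rightarrow> ereal" where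
  "pred k = objective (x k) - q k (xhat k)"

definition ared :: "nat \<Rightarrow> ereal" where
  "ared k = objective (x k) - objective (xhat k)"

text \<open>The ratio is only relevant when \<open>pred k\<close> is positive: otherwise the first alternative of
  \<open>unsuccessful\<close> holds.\<close>

definition rho :: "nat \<Rightarrow> ereal" where
  "rho k = ared k / pred k"

definition unsuccessful :: "nat \<Rightarrow> bool" where
  "unsuccessful k \<longleftrightarrow>
     pred k \<le> ereal (pmin * (1 - \<theta>) * norm (d k) * min (r k) (r k powr \<kappa>))
     \<or> rho k \<le> ereal c\<^sub>1"

definition reset_indices :: "nat set" where
  "reset_indices = {0} \<union> {k. k \<ge> 1 \<and> norm (residual (x k)) \<le> \<eta> * rbar (k - 1)}"

end

locale rpn_method =
  composite_problem A b \<psi> \<phi> +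
  rpn_data A b \<psi> \<phi> c\<^sub>1 c\<^sub>2 \<sigma>\<^sub>1 \<sigma>\<^sub>2 \<eta> \<theta> \<alpha> a \<nu>min \<nu>max \<delta> \<tau> pmin \<kappa> x xhat \<nu> rbar
  for A :: "real ^ 'n ^ 'm" and b :: "real ^ 'm"
    and \<psi> :: "real ^ 'm \<Rightarrow> ereal" and \<phi> :: "real ^ 'n \<Rightarrow> ereal"
    and c\<^sub>1 c\<^sub>2 \<sigma>\<^sub>1 \<sigma>\<^sub>2 \<eta> \<theta> \<alpha> a \<nu>min \<nu>max \<delta> \<tau> pmin \<kappa> :: real
    and x xhat :: "nat \<Rightarrow> real ^ 'n" and \<nu> rbar :: "nat \<Rightarrow> real" +
  assumes c_bounds: "0 < c\<^sub>1" "c\<^sub>1 < c\<^sub>2" "c\<^sub>2 < 1"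
    and sigma1: "0 < \<sigma>\<^sub>1" "\<sigma>\<^sub>1 < 1" and sigma2: "1 < \<sigma>\<^sub>2"
    and eta: "0 < \<eta>" "\<eta> < 1" and theta: "0 < \<theta>" "\<theta> < 1" and alpha: "0 < \<alpha>" "\<alpha> < 1"
    and a: "1 \<le> a"
    and nu_bounds: "0 < \<nu>min" "\<nu>min \<le> \<nu> 0" "\<nu> 0 \<le> \<nu>max"
    and delta: "0 < \<delta>" "\<delta> \<le> 1" and tau: "\<delta> \<le> \<tau>"
    and pmin: "0 < pmin" "pmin < 1 / 2" and kappa: "1 + \<delta> < \<kappa>"
    and start: "x 0 \<in> effdom \<phi>" "rbar 0 = r 0"
    and inexact_residual: "\<And>k. norm (R k (xhat k)) \<le> \<theta> * min (r k) (r k powr (1 + \<tau>))"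
    and inexact_decrease: "\<And>k. objective (x k) - qhat k (xhat k)
          \<ge> ereal (\<alpha> * mu k / 2 * (norm (xhat k - x k))\<^sup>2)"
    and unsuccessful_step: "\<And>k. unsuccessful k \<Longrightarrow> x (Suc k) = x k \<and> \<nu> (Suc k) = \<sigma>\<^sub>2 * \<nu> k"
    and successful_step: "\<And>k. \<not> unsuccessful k \<Longrightarrow> rho k \<le> ereal c\<^sub>2 \<Longrightarrow>
          x (Suc k) = xhat k \<and> \<nu> (Suc k) = min (\<nu> k) \<nu>max"
    and highly_successful_step: "\<And>k. \<not> unsuccessful k \<Longrightarrow> rho k > ereal c\<^sub>2 \<Longrightarrow>
          x (Suc k) = xhat k \<and> \<nu> (Suc k) = min (max (\<sigma>\<^sub>1 * \<nu> k) \<nu>min) \<nu>max"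
    and rbar_step: "\<And>k. rbar (Suc k) = (if r (Suc k) \<le> \<eta> * rbar k then r (Suc k) else rbar k)"

section \<open>Rate of convergence\<close>

definition converges_to_0_at_rate :: "(nat \<Rightarrow> real) \<Rightarrow> real \<Rightarrow> bool" where
  "converges_to_0_at_rate t p \<longleftrightarrow> t \<longlonglongrightarrow> 0 \<and>
     (\<exists>C>0. eventually (\<lambda>k. t (Suc k) \<le> C * t k powr p) sequentially)"

end

theory Submission
  imports Defs
begin

text \<open>Let \<open>k\<close> be a reset index with \<open>x k\<close> close to \<open>xstar\<close>, and put \<open>t = r k\<close>. Then \<open>rbar k = t\<close>, and
  the previous step was successful, so \<open>mu k\<close> lies between constant multiples of \<open>t powr \<delta>\<close>. The error
  bound yields \<open>xbar\<close> in \<open>Xstar\<close> whose distance \<open>S\<close> from \<open>x k\<close> is \<open>O(t powr q)\<close>; in particular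
  \<open>S\<^sup>2 = O(mu k * S)\<close> and \<open>Lambda k = O(S)\<close>. Monotonicity of the subdifferential of \<open>\<phi>\<close> between \<open>xbar\<close>
  and the inexact minimizer gives a quadratic inequality for \<open>norm (xhat k - xbar)\<close> that forces
  \<open>norm (d k) = O(S)\<close>. Since the residual at \<open>xhat k\<close> differs from the model residual by at most
  the model error of the gradient, it is \<open>O(t powr min (1 + \<tau>) (\<delta> + q))\<close>. The third-order error of the
  quadratic model is negligible against \<open>pred k \<ge> mu k / 2 * (norm (d k))\<^sup>2\<close> because \<open>q > \<delta>\<close>, so
  the step is accepted and \<open>k + 1\<close> is a reset index again. As the residuals shrink geometrically, the
  step lengths are summable with an arbitrarily small sum, and the iterates never leave the
  neighbourhood.\<close>

section \<open>Symmetric matrices\<close>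

text \<open>A minimizer of the Rayleigh quotient on the unit sphere is an eigenvector, and the
  quotient bound excludes smaller eigenvalues. This is what makes the \<open>LEAST\<close> in
  \<open>lambda_min\<close> denote an eigenvalue.\<close>

lemma symmetric_least_eigenvalue:
  fixes M :: "real ^ 'n ^ 'n"
  assumes sym: "\<And>u v. u \<bullet> (M *v v) = v \<bullet> (M *v u)"
  shows "real_eigenvalue M (lambda_min M)"
    and "lambda_min M * (norm w)\<^sup>2 \<le> w \<bullet> (M *v w)"
proof -
  have cont: "continuous_on (sphere 0 1) (\<lambda>w::real^'n. w \<bullet> (M *v w))"
    by (intro continuous_intros linear_continuous_on matrix_vector_mul_bounded_linear)
  have "sphere (0::real^'n) 1 \<noteq> {}" by (simp add: sphere_eq_empty)
  then obtain v where v: "norm v = 1" and min: "\<And>w. norm w = 1 \<Longrightarrow> v \<bullet> (M *v v) \<le> w \<bullet> (M *v w)"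
    using continuous_attains_inf[OF compact_sphere _ cont] by auto
  define m where "m = v \<bullet> (M *v v)"
  have ray: "m * (norm w)\<^sup>2 \<le> w \<bullet> (M *v w)" for w
  proof (cases "w = 0")
    case False
    have "m \<le> (inverse (norm w) *\<^sub>R w) \<bullet> (M *v (inverse (norm w) *\<^sub>R w))"
      unfolding m_def by (rule min) (use False in simp)
    also have "\<dots> = w \<bullet> (M *v w) / (norm w)\<^sup>2"
      by (simp add: matrix_vector_mult_scaleR power2_eq_square field_simps)
    finally show ?thesis using False by (simp add: field_simps)
  qed simp
  \<comment> \<open>Up to a factor 2, \<open>g\<close> is the gradient at \<open>v\<close> of
    \<open>w \<bullet> (M *v w) - m * (norm w)\<^sup>2\<close>, which is nonnegative and vanishes at
    \<open>v\<close>. Moving by \<open>- t *\<^sub>R g\<close> and letting \<open>t\<close> tend to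
    0 forces \<open>g = 0\<close>.\<close>
  define g where "g = M *v v - m *\<^sub>R v"
  have key: "2 * (g \<bullet> g) \<le> t * (g \<bullet> (M *v g) - m * (g \<bullet> g))" if t: "0 < t" for t
  proof -
    have "m * (norm (v - t *\<^sub>R g))\<^sup>2 \<le> (v - t *\<^sub>R g) \<bullet> (M *v (v - t *\<^sub>R g))" by (rule ray)
    moreover have "(norm (v - t *\<^sub>R g))\<^sup>2 = 1 - 2 * t * (v \<bullet> g) + t * t * (g \<bullet> g)"
      using v by (simp add: power2_norm_eq_inner inner_diff inner_commute algebra_simps norm_eq_1)
    moreover have "(v - t *\<^sub>R g) \<bullet> (M *v (v - t *\<^sub>R g))
        = m - 2 * t * (g \<bullet> (M *v v)) + t * t * (g \<bullet> (M *v g))"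
      using sym[of v g] by (simp add: m_def inner_diff inner_commute algebra_simps
          matrix_vector_mult_diff_distrib matrix_vector_mult_scaleR)
    moreover have "g \<bullet> (M *v v) = g \<bullet> g + m * (v \<bullet> g)"
      by (simp add: g_def inner_diff inner_commute algebra_simps)
    ultimately have "t * (2 * (g \<bullet> g)) \<le> t * (t * (g \<bullet> (M *v g) - m * (g \<bullet> g)))"
      by (simp add: algebra_simps)
    then show ?thesis using t by (simp add: mult_le_cancel_left_pos)
  qed
  have "((\<lambda>t. t * (g \<bullet> (M *v g) - m * (g \<bullet> g))) \<longlongrightarrow> 0 * (g \<bullet> (M *v g) - m * (g \<bullet> g))) (at_right 0)"
    by (intro tendsto_intros)
  moreover have "eventually (\<lambda>t. 2 * (g \<bullet> g) \<le> t * (g \<bullet> (M *v g) - m * (g \<bullet> g))) (at_right 0)"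
    unfolding eventually_at_right_field using key by (intro exI[of _ 1]) auto
  ultimately have "2 * (g \<bullet> g) \<le> 0 * (g \<bullet> (M *v g) - m * (g \<bullet> g))"
    by (intro tendsto_lowerbound[where F = "at_right 0"]) auto
  then have "g \<bullet> g \<le> 0" by simp
  then have "g = 0" by (metis inner_eq_zero_iff inner_ge_zero order_antisym)
  then have ev: "real_eigenvalue M m"
    using v by (auto simp: real_eigenvalue_def g_def intro!: exI[of _ v])
  have "m \<le> l" if l: "real_eigenvalue M l" for l
  proof -
    obtain w where w: "w \<noteq> 0" "M *v w = l *\<^sub>R w" using l by (auto simp: real_eigenvalue_def)
    then show ?thesis using ray[of w] by (simp add: power2_norm_eq_inner)
  qed
  then have "lambda_min M = m" unfolding lambda_min_def using ev by (intro Least_equality)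
  then show "real_eigenvalue M (lambda_min M)" "lambda_min M * (norm w)\<^sup>2 \<le> w \<bullet> (M *v w)"
    using ev ray by auto
qed

section \<open>Gradients and Hessians\<close>

lemma gradient_eqI:
  assumes "(g has_derivative (\<lambda>h. h \<bullet> D)) (at x)"
  shows "gradient g x = D"
  unfolding gradient_def
proof (rule the_equality)
  show "GDERIV g x :> D" using assms by (simp add: gderiv_def)
  fix E assume "GDERIV g x :> E"
  then have "(\<lambda>h. h \<bullet> E) = (\<lambda>h. h \<bullet> D)"
    using has_derivative_unique assms unfolding gderiv_def by blast
  then show "E = D" by (metis inner_commute vector_eq_ldot)
qed

lemma gradient_works:
  assumes "g differentiable (at x)"
  shows "(g has_derivative (\<lambda>h. h \<bullet> gradient g x)) (at x)"
proof -
  obtain g' where g': "(g has_derivative g') (at x)" using assms by (auto simp: differentiable_def)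
  then have lin: "linear g'" by (rule has_derivative_linear)
  \<comment> \<open>The adjoint of a linear functional, evaluated at \<open>1\<close>, is its Riesz
    representer.\<close>
  have "g' = (\<lambda>h. h \<bullet> adjoint g' 1)" using adjoint_works[OF lin, of _ 1] by auto
  with g' have d: "(g has_derivative (\<lambda>h. h \<bullet> adjoint g' 1)) (at x)" by simp
  from gradient_eqI[OF d] d show ?thesis by simp
qed

lemma hessian_works:
  assumes "gradient g differentiable (at x)"
  shows "(gradient g has_derivative (\<lambda>h. hessian g x *v h)) (at x)"
  using assms unfolding hessian_def by (simp add: jacobian_works[symmetric])

lemma hessian_eqI:
  assumes "(gradient g has_derivative (\<lambda>h. M *v h)) (at x)"
  shows "hessian g x = M"
proof -
  have "frechet_derivative (gradient g) (at x) = (\<lambda>h. M *v h)"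
    using frechet_derivative_at[OF assms] by simp
  then show ?thesis by (simp add: hessian_def jacobian_def matrix_of_matrix_vector_mul)
qed

text \<open>The mean value theorem in direction \<open>u\<close> and differentiability of the gradient in direction \<open>v\<close>;
  since the second difference is symmetric in \<open>u\<close> and \<open>v\<close>, so is the Hessian.\<close>

lemma second_difference:
  fixes g :: "real ^ 'n \<Rightarrow> real"
  assumes "open U" "z \<in> U" and diff: "\<And>y. y \<in> U \<Longrightarrow> g differentiable (at y)"
    and diff2: "gradient g differentiable (at z)" and e: "0 < e"
  shows "eventually (\<lambda>t. \<bar>g (z + t *\<^sub>R u + t *\<^sub>R v) - g (z + t *\<^sub>R u) - g (z + t *\<^sub>R v) + g z
           - t * t * (u \<bullet> (hessian g z *v v))\<bar> \<le> e * (t * t)) (at_right 0)"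
proof -
  define K where "K = norm u + norm v + 1"
  have K: "0 < K" by (simp add: K_def add_nonneg_pos)
  \<comment> \<open>Two gradient errors of size \<open>c * (t * K)\<close> arise below, and pairing
    with \<open>u\<close> costs another factor \<open>K\<close>; the total is exactly
    \<open>e * t\<close>.\<close>
  define c where "c = e / (2 * K * K)"
  have c: "0 < c" using e K by (simp add: c_def)
  obtain d1 where d1: "0 < d1" "\<And>y. norm (y - z) < d1 \<Longrightarrow>
      norm (gradient g y - gradient g z - hessian g z *v (y - z)) \<le> c * norm (y - z)"
    using hessian_works[OF diff2] c unfolding has_derivative_at_alt by blast
  obtain d2 where d2: "0 < d2" "ball z d2 \<subseteq> U" using assms(1,2) openE by blast
  define d where "d = min d1 d2 / K"
  have d: "0 < d" using d1 d2 K by (simp add: d_def)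
  have main: "\<bar>g (z + t *\<^sub>R u + t *\<^sub>R v) - g (z + t *\<^sub>R u) - g (z + t *\<^sub>R v) + g z
           - t * t * (u \<bullet> (hessian g z *v v))\<bar> \<le> e * (t * t)" if t: "0 < t" "t < d" for t
  proof -
    have tK: "t * K < d1" "t * K < d2" using t K by (auto simp: d_def field_simps)
    have small: "norm (s *\<^sub>R u + s' *\<^sub>R v) \<le> t * K" if "0 \<le> s" "s \<le> t" "0 \<le> s'" "s' \<le> t" for s s'
    proof -
      have "norm (s *\<^sub>R u + s' *\<^sub>R v) \<le> s * norm u + s' * norm v"
        using norm_triangle_ineq[of "s *\<^sub>R u" "s' *\<^sub>R v"] that by simp
      also have "\<dots> \<le> t * norm u + t * norm v" using that by (intro add_mono mult_right_mono) auto
      finally show ?thesis using t by (simp add: K_def algebra_simps)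
    qed
    have inU: "z + s *\<^sub>R u + s' *\<^sub>R v \<in> U" if "0 \<le> s" "s \<le> t" "0 \<le> s'" "s' \<le> t" for s s'
      using small[OF that] d2(2) tK by (auto simp: dist_norm subset_iff norm_minus_commute add.assoc
          intro!: d2(2)[THEN subsetD])
    \<comment> \<open>The second difference is the increment of \<open>F\<close> over
      \<open>{0..t}\<close>, so a single application of the mean value theorem leaves a difference
      of two gradients near \<open>z\<close>. The term \<open>0 *\<^sub>R v\<close> lets
      \<open>der\<close> cover both summands.\<close>
    define F where "F s = g (z + s *\<^sub>R u + t *\<^sub>R v) - g (z + s *\<^sub>R u + 0 *\<^sub>R v)" for s
    define F' where "F' s h = (h *\<^sub>R u) \<bullet> gradient g (z + s *\<^sub>R u + t *\<^sub>R v)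
        - (h *\<^sub>R u) \<bullet> gradient g (z + s *\<^sub>R u + 0 *\<^sub>R v)" for s h
    have der: "((\<lambda>s. g (z + s *\<^sub>R u + s' *\<^sub>R v)) has_derivative
        (\<lambda>h. (h *\<^sub>R u) \<bullet> gradient g (z + s *\<^sub>R u + s' *\<^sub>R v))) (at s within {0..t})"
      if "0 \<le> s" "s \<le> t" "0 \<le> s'" "s' \<le> t" for s s'
    proof -
      have "((\<lambda>s. z + s *\<^sub>R u + s' *\<^sub>R v) has_derivative (\<lambda>h. h *\<^sub>R u)) (at s within {0..t})"
        by (auto intro!: derivative_eq_intros)
      from has_derivative_compose[OF this gradient_works[OF diff[OF inU[OF that]]]]
      show ?thesis .
    qed
    have "\<exists>s\<in>{0<..<t}. F t - F 0 = F' s (t - 0)"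
      unfolding F_def F'_def using t by (intro mvt_simple has_derivative_diff der) auto
    then obtain s where s: "0 < s" "s < t" "F t - F 0 = F' s t" by auto
    define E where "E y = gradient g y - gradient g z - hessian g z *v (y - z)" for y
    have E: "norm (E (z + s *\<^sub>R u + s' *\<^sub>R v)) \<le> c * (t * K)" if "0 \<le> s'" "s' \<le> t" for s'
    proof -
      have n: "norm (s *\<^sub>R u + s' *\<^sub>R v) \<le> t * K" using small s that by simp
      have "norm (E (z + s *\<^sub>R u + s' *\<^sub>R v)) \<le> c * norm (z + s *\<^sub>R u + s' *\<^sub>R v - z)"
        unfolding E_def by (rule d1(2)) (use n tK in \<open>simp add: add.assoc\<close>)
      also have "\<dots> \<le> c * (t * K)" using n c by (simp add: add.assoc)
      finally show ?thesis .
    qed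
    let ?y1 = "z + s *\<^sub>R u + t *\<^sub>R v" and ?y0 = "z + s *\<^sub>R u + 0 *\<^sub>R v"
    have "gradient g ?y1 - gradient g ?y0 = t *\<^sub>R (hessian g z *v v) + (E ?y1 - E ?y0)"
      by (simp add: E_def algebra_simps matrix_vector_mult_scaleR)
    then have "F' s t = t * (u \<bullet> (t *\<^sub>R (hessian g z *v v) + (E ?y1 - E ?y0)))"
      unfolding F'_def by (metis inner_diff_right inner_scaleR_left)
    then have Feq: "F t - F 0 - t * t * (u \<bullet> (hessian g z *v v)) = t * (u \<bullet> (E ?y1 - E ?y0))"
      using s(3) by (simp add: algebra_simps inner_add_right)
    have "\<bar>u \<bullet> (E ?y1 - E ?y0)\<bar> \<le> norm u * norm (E ?y1 - E ?y0)" by (rule Cauchy_Schwarz_ineq2)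
    also have "\<dots> \<le> K * (c * (t * K) + c * (t * K))"
    proof (rule mult_mono)
      show "norm (E ?y1 - E ?y0) \<le> c * (t * K) + c * (t * K)"
        using E[of t] E[of 0] norm_triangle_ineq4[of "E ?y1" "E ?y0"] t by linarith
    qed (use K in \<open>auto simp: K_def\<close>)
    also have "\<dots> = e * t" using K by (simp add: c_def field_simps)
    finally have "t * \<bar>u \<bullet> (E ?y1 - E ?y0)\<bar> \<le> t * (e * t)" using t by (intro mult_left_mono) auto
    then have "\<bar>F t - F 0 - t * t * (u \<bullet> (hessian g z *v v))\<bar> \<le> e * (t * t)"
      unfolding Feq using t by (simp add: abs_mult mult.left_commute)
    then show ?thesis by (simp add: F_def algebra_simps)
  qed
  then show ?thesis unfolding eventually_at_right_field using d by (intro exI[of _ d]) auto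
qed

lemma hessian_symmetric:
  fixes g :: "real ^ 'n \<Rightarrow> real"
  assumes "open U" "z \<in> U" "\<And>y. y \<in> U \<Longrightarrow> g differentiable (at y)"
    and "gradient g differentiable (at z)"
  shows "u \<bullet> (hessian g z *v v) = v \<bullet> (hessian g z *v u)"
proof -
  let ?a = "u \<bullet> (hessian g z *v v)" and ?b = "v \<bullet> (hessian g z *v u)"
  have "\<bar>?a - ?b\<bar> \<le> 2 * e" if e: "0 < e" for e
  proof -
    have sd: "eventually (\<lambda>t. \<bar>g (z + t *\<^sub>R u + t *\<^sub>R v) - g (z + t *\<^sub>R u) - g (z + t *\<^sub>R v) + g z
           - t * t * (u \<bullet> (hessian g z *v v))\<bar> \<le> e * (t * t)) (at_right 0)" for u v
      using assms e by (intro second_difference)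
    have "eventually (\<lambda>t::real. \<bar>?a - ?b\<bar> \<le> 2 * e) (at_right 0)"
      using sd[of u v] sd[of v u] eventually_at_right_less[of 0]
    proof eventually_elim
      case (elim t)
      have eq: "z + t *\<^sub>R v + t *\<^sub>R u = z + t *\<^sub>R u + t *\<^sub>R v" by simp
      from elim(1) elim(2)[unfolded eq] have "\<bar>t * t * ?a - t * t * ?b\<bar> \<le> 2 * (e * (t * t))" by linarith
      moreover have "t * t * ?a - t * t * ?b = t * t * (?a - ?b)" by (rule right_diff_distrib[symmetric])
      ultimately have "t * t * \<bar>?a - ?b\<bar> \<le> t * t * (2 * e)"
        by (simp only: abs_mult abs_mult_self_eq) (simp add: mult.left_commute mult.commute)
      then show ?case using elim(3) by (simp add: mult_le_cancel_left_pos)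
    qed
    then show ?thesis by (simp add: eventually_const)
  qed
  \<comment> \<open>With \<open>e\<close> a quarter of the gap, the gap is at most half of
    itself.\<close>
  from this[of "\<bar>?a - ?b\<bar> / 4"] show ?thesis by (cases "?a = ?b") auto
qed

section \<open>Proximal map of a convex function\<close>

text \<open>Turns the definition by \<open>Liminf\<close> over the punctured neighbourhood filter
  into open superlevel sets, the form that compactness arguments use. The value at \<open>y\<close>
  itself is covered by membership in the set.\<close>

lemma lsc_imp_open_superlevel:
  fixes g :: "'a::topological_space \<Rightarrow> ereal"
  assumes "lsc g"
  shows "open {y. c < g y}"
proof (subst open_subopen, intro ballI)
  fix y assume "y \<in> {y. c < g y}"
  then have y: "c < g y" by simp
    have "g y \<le> Liminf (at y) g" using assms by (simp add: lsc_def)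
    then have "eventually (\<lambda>z. c < g z) (at y)" using y by (simp add: le_Liminf_iff)
    then have "eventually (\<lambda>z. c < g z) (nhds y)"
      using y by (auto simp: eventually_at_filter elim: eventually_mono)
    then show "\<exists>T. open T \<and> y \<in> T \<and> T \<subseteq> {y. c < g y}"
      by (auto simp: eventually_nhds)
qed

text \<open>Without a minimizer the open sets \<open>{z. g y < g z}\<close> with \<open>y\<close> in
  \<open>K\<close> would cover \<open>K\<close>; in a finite subcover, the centre with the smallest
  value is left uncovered.\<close>

lemma lsc_attains_inf:
  fixes g :: "'a::topological_space \<Rightarrow> ereal"
  assumes lsc: "\<And>c. open {y. c < g y}" and "compact K" "K \<noteq> {}"
  obtains p where "p \<in> K" "\<And>y. y \<in> K \<Longrightarrow> g p \<le> g y"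
proof -
  have "\<exists>p\<in>K. \<forall>y\<in>K. g p \<le> g y"
  proof (rule ccontr)
    assume "\<not> ?thesis"
    then have "K \<subseteq> (\<Union>y\<in>K. {z. g y < g z})" by (auto simp: not_le)
    then obtain Y where Y: "Y \<subseteq> K" "finite Y" "K \<subseteq> (\<Union>y\<in>Y. {z. g y < g z})"
      using compactE_image[OF \<open>compact K\<close>, of K "\<lambda>y. {z. g y < g z}"] lsc by metis
    then have "Y \<noteq> {}" using \<open>K \<noteq> {}\<close> by auto
    with Y(2) obtain y0 where y0: "y0 \<in> Y" "\<And>y. y \<in> Y \<Longrightarrow> g y0 \<le> g y"
      by (metis (no_types, lifting) arg_min_if_finite(1) arg_min_least)
    then obtain y where "y \<in> Y" "g y < g y0" using Y by blast
    with y0(2) show False by (auto simp: not_le[symmetric])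
  qed
  then show ?thesis using that by blast
qed

text \<open>A real \<open>e\<close> between \<open>c - h y\<close> and \<open>g y\<close> splits the
  inequality into two open conditions, one on \<open>g\<close> and one on \<open>h\<close>.\<close>

lemma lsc_plus_continuous:
  fixes g :: "'a::topological_space \<Rightarrow> ereal" and h :: "'a \<Rightarrow> real"
  assumes "lsc g" "continuous_on UNIV h" "\<And>x. g x \<noteq> -\<infinity>"
  shows "open {y. c < g y + ereal (h y)}"
proof (subst open_subopen, intro ballI)
  fix y assume "y \<in> {y. c < g y + ereal (h y)}"
  then have "c - ereal (h y) < g y"
    using assms(3)[of y] by (cases c; cases "g y") auto
  then obtain e where e: "c - ereal (h y) < ereal e" "ereal e < g y"
    using ereal_dense2 by blast
  let ?T = "{z. ereal e < g z} \<inter> {z. c < ereal (e + h z)}"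
  have o: "open {z. c < ereal (e + h z)}"
    by (intro open_Collect_less continuous_intros assms(2))
  have "open ?T" using lsc_imp_open_superlevel[OF assms(1)] o by blast
  moreover have "y \<in> ?T" using e by (cases c) auto
  moreover have "?T \<subseteq> {y. c < g y + ereal (h y)}"
  proof
    fix z assume "z \<in> ?T"
    then have z: "ereal e < g z" "c < ereal (e + h z)" by auto
    have "ereal (e + h z) \<le> g z + ereal (h z)" using z(1) by (cases "g z") auto
    then show "z \<in> {y. c < g y + ereal (h y)}" using z(2) by (auto intro: less_le_trans)
  qed
  ultimately show "\<exists>T. open T \<and> y \<in> T \<and> T \<subseteq> {y. c < g y + ereal (h y)}" by blast
qed

section \<open>Proper lower semicontinuous convex functions\<close>

locale proper_convex =
  fixes \<phi> :: "'a::euclidean_space \<Rightarrow> ereal"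
  assumes propphi: "proper \<phi>" and lscphi: "lsc \<phi>" and convphi: "convex_ereal \<phi>"
begin

text \<open>Outside \<open>effdom \<phi>\<close> this is the default value \<open>0\<close>; it
  stands for \<open>\<phi>\<close> only at points of the domain.\<close>

abbreviation "ph y \<equiv> real_of_ereal (\<phi> y)"

lemma phi_eq: "y \<in> effdom \<phi> \<Longrightarrow> \<phi> y = ereal (ph y)"
  using propphi by (cases "\<phi> y") (auto simp: effdom_def proper_def)

lemma phi_infinite: "y \<notin> effdom \<phi> \<Longrightarrow> \<phi> y = \<infinity>"
  by (auto simp: effdom_def)

text \<open>Moves convexity from \<open>ereal\<close> to real arithmetic and adds the endpoints of
  the segment, which \<open>convex_ereal\<close> leaves out.\<close>

lemma phi_convex:
  assumes "x \<in> effdom \<phi>" "y \<in> effdom \<phi>" "0 \<le> t" "t \<le> 1"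
  shows "(1 - t) *\<^sub>R x + t *\<^sub>R y \<in> effdom \<phi>"
    and "ph ((1 - t) *\<^sub>R x + t *\<^sub>R y) \<le> (1 - t) * ph x + t * ph y"
proof -
  have "(1 - t) *\<^sub>R x + t *\<^sub>R y \<in> effdom \<phi> \<and>
    ph ((1 - t) *\<^sub>R x + t *\<^sub>R y) \<le> (1 - t) * ph x + t * ph y"
  proof (cases "t = 0 \<or> t = 1")
    case False
    then have t: "0 < t" "t < 1" using assms by auto
    let ?z = "(1 - t) *\<^sub>R x + t *\<^sub>R y"
    have "\<phi> ?z \<le> ereal (1 - t) * \<phi> x + ereal t * \<phi> y"
      using convphi t by (simp add: convex_ereal_def)
    also have "\<dots> = ereal ((1 - t) * ph x + t * ph y)"
      using phi_eq[OF assms(1)] phi_eq[OF assms(2)]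
      by (metis plus_ereal.simps(1) times_ereal.simps(1))
    finally have le: "\<phi> ?z \<le> ereal ((1 - t) * ph x + t * ph y)" .
    then have "?z \<in> effdom \<phi>" by (auto simp: effdom_def intro: le_less_trans)
    moreover from this have "ph ?z \<le> (1 - t) * ph x + t * ph y"
      using le phi_eq by (metis ereal_less_eq(3))
    ultimately show ?thesis by blast
  qed (use assms in auto)
  then show "(1 - t) *\<^sub>R x + t *\<^sub>R y \<in> effdom \<phi>"
    "ph ((1 - t) *\<^sub>R x + t *\<^sub>R y) \<le> (1 - t) * ph x + t * ph y" by auto
qed

lemma convex_effdom: "convex (effdom \<phi>)"
  unfolding convex_alt using phi_convex(1) by blast

text \<open>Compactness bounds \<open>\<phi>\<close> below on the unit ball around
  \<open>x0\<close>; convexity along rays from \<open>x0\<close> then permits at most linear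
  decrease. This makes the objective of the proximal problem coercive.\<close>

lemma phi_lower_growth:
  obtains x0 c where "x0 \<in> effdom \<phi>" "0 \<le> c"
    "\<And>y. y \<in> effdom \<phi> \<Longrightarrow> 1 \<le> norm (y - x0) \<Longrightarrow> ph x0 - c * norm (y - x0) \<le> ph y"
proof -
  obtain x0 where x0: "x0 \<in> effdom \<phi>" using propphi by (auto simp: proper_def)
  obtain p where p: "p \<in> cball x0 1" "\<And>y. y \<in> cball x0 1 \<Longrightarrow> \<phi> p \<le> \<phi> y"
    using lsc_attains_inf[OF lsc_imp_open_superlevel[OF lscphi], of "cball x0 1"]
    by (metis cball_eq_empty compact_cball not_one_less_zero)
  have "\<phi> p \<le> \<phi> x0" using p by simp
  then have pd: "p \<in> effdom \<phi>" using x0 by (auto simp: effdom_def)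
  let ?c = "ph x0 - ph p"
  have pl: "ph p \<le> ph y" if "y \<in> cball x0 1" "y \<in> effdom \<phi>" for y
    using p(2)[OF that(1)] phi_eq[OF pd] phi_eq[OF that(2)] by (metis ereal_less_eq(3))
  have "ph x0 - ?c * norm (y - x0) \<le> ph y" if y: "y \<in> effdom \<phi>" "1 \<le> norm (y - x0)" for y
  proof -
    let ?D = "norm (y - x0)"
    let ?t = "1 / ?D"
    let ?z = "(1 - ?t) *\<^sub>R x0 + ?t *\<^sub>R y"
    have t: "0 \<le> ?t" "?t \<le> 1" using y by (auto simp: divide_le_eq_1)
    have "?z - x0 = ?t *\<^sub>R (y - x0)" by (simp add: algebra_simps)
    moreover have "y \<noteq> x0" using y(2) by auto
    ultimately have "norm (?z - x0) = 1" by simp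
    then have "?z \<in> cball x0 1" by (simp add: dist_norm norm_minus_commute)
    then have "ph p \<le> ph ?z" using pl phi_convex(1)[OF x0 y(1) t] by blast
    also have "\<dots> \<le> (1 - ?t) * ph x0 + ?t * ph y" by (rule phi_convex(2)[OF x0 y(1) t])
    finally have "?D * ph p \<le> ?D * ((1 - ?t) * ph x0 + ?t * ph y)"
      by (intro mult_left_mono) auto
    also have "\<dots> = (?D - 1) * ph x0 + ph y" using y(2) by (auto simp: field_simps)
    finally show ?thesis by (simp add: algebra_simps)
  qed
  then show ?thesis using that[OF x0, of ?c] pl[OF _ x0] by simp
qed

text \<open>The quadratic term dominates the linear decrease of \<open>\<phi>\<close>, so a
  minimizer over a large ball is global and the \<open>ARG_MIN\<close> in \<open>prox\<close> is a
  true minimizer.\<close>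

lemma prox_minimizes:
  "\<phi> (prox \<phi> x) + ereal ((norm (prox \<phi> x - x))\<^sup>2 / 2) \<le> \<phi> y + ereal ((norm (y - x))\<^sup>2 / 2)"
proof -
  let ?g = "\<lambda>y. \<phi> y + ereal ((norm (y - x))\<^sup>2 / 2)"
  obtain x0 c where x0: "x0 \<in> effdom \<phi>" "0 \<le> c"
    and gr: "\<And>y. y \<in> effdom \<phi> \<Longrightarrow> 1 \<le> norm (y - x0) \<Longrightarrow> ph x0 - c * norm (y - x0) \<le> ph y"
    using phi_lower_growth by blast
  define e where "e = norm (x0 - x)"
  \<comment> \<open>Beyond this radius \<open>D - 2 * e\<close> is at least \<open>2 * c\<close>, so
    the quadratic term exceeds its value at \<open>x0\<close> by at least \<open>c * D\<close>,
    which pays for the decrease of \<open>\<phi>\<close>.\<close>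
  define rad where "rad = max 1 (2 * (e + c))"
  have op: "open {y. k < ?g y}" for k
    by (rule lsc_plus_continuous[OF lscphi])
      (use propphi in \<open>auto intro!: continuous_intros simp: proper_def\<close>)
  obtain p where p: "p \<in> cball x0 rad" "\<And>y. y \<in> cball x0 rad \<Longrightarrow> ?g p \<le> ?g y"
    using lsc_attains_inf[OF op, of "cball x0 rad"]
    by (metis cball_eq_empty compact_cball le_max_iff_disj not_less rad_def zero_less_one_class.zero_le_one)
  have px0: "?g p \<le> ?g x0" using p by (simp add: rad_def)
  have glob: "?g p \<le> ?g z" for z
  proof (cases "z \<in> cball x0 rad \<or> z \<notin> effdom \<phi>")
    case True
    then show ?thesis using p phi_infinite[of z] by auto
  next
    case False
    define D where "D = norm (z - x0)"
    have D: "1 \<le> D" "2 * (e + c) \<le> D"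
      using False by (auto simp: rad_def dist_norm norm_minus_commute D_def)
    have e0: "0 \<le> e" by (simp add: e_def)
    have nz: "D - e \<le> norm (z - x)"
      using norm_triangle_ineq2[of "z - x0" "x - x0"] by (simp add: D_def e_def norm_minus_commute)
    have "e \<le> D" using D(2) x0(2) e0 by argo
    then have "0 \<le> D - e" by simp
    then have "(D - e)\<^sup>2 \<le> (norm (z - x))\<^sup>2" using nz by (intro power_mono) auto
    moreover have "(D - e)\<^sup>2 = D * (D - 2 * e) + e\<^sup>2" by (simp add: power2_eq_square algebra_simps)
    moreover have "D * (2 * c) \<le> D * (D - 2 * e)" using D by (intro mult_left_mono) auto
    moreover have "ph x0 - c * D \<le> ph z" using gr False D by (simp add: D_def)
    ultimately have "ph x0 + e\<^sup>2 / 2 \<le> ph z + (norm (z - x))\<^sup>2 / 2" by (simp add: algebra_simps)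
    then have "?g x0 \<le> ?g z" using phi_eq[OF x0(1)] phi_eq[of z] False
      by (metis e_def ereal_less_eq(3) plus_ereal.simps(1))
    with px0 show ?thesis by (rule order_trans)
  qed
  have "is_arg_min ?g (\<lambda>_. True) (prox \<phi> x)"
    unfolding prox_def arg_min_def
    by (rule someI[where P = "is_arg_min ?g (\<lambda>_. True)" and x = p]) (auto simp: is_arg_min_def not_less glob)
  then show ?thesis by (auto simp: is_arg_min_def not_less)
qed

lemma prox_effdom: "prox \<phi> x \<in> effdom \<phi>"
proof -
  obtain x0 where "x0 \<in> effdom \<phi>" using propphi by (auto simp: proper_def)
  then show ?thesis using prox_minimizes[of x x0] phi_eq[of x0] phi_infinite[of "prox \<phi> x"]
    by (metis PInfty_neq_ereal(1) ereal_infty_less_eq(1) plus_ereal.simps(1) plus_ereal.simps(2))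
qed

lemma subdifferential_iff:
  "v \<in> subdifferential \<phi> x \<longleftrightarrow>
     x \<in> effdom \<phi> \<and> (\<forall>y\<in>effdom \<phi>. ph x + v \<bullet> (y - x) \<le> ph y)"
  unfolding subdifferential_def mem_Collect_eq
  using phi_eq phi_infinite
  by (metis ereal_less_eq(1) ereal_less_eq(3) plus_ereal.simps(1))

text \<open>First-order optimality of the proximal problem: compare the minimizer with points of the
  segment towards \<open>y\<close>, divide by \<open>t\<close>, and let \<open>t\<close> tend to
  0.\<close>

lemma prox_subgradient: "x - prox \<phi> x \<in> subdifferential \<phi> (prox \<phi> x)"
  unfolding subdifferential_iff
proof (intro conjI ballI)
  let ?p = "prox \<phi> x"
  show pd: "?p \<in> effdom \<phi>" by (rule prox_effdom)
  fix y assume y: "y \<in> effdom \<phi>"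
  let ?B = "(norm (y - ?p))\<^sup>2"
  have key: "ph ?p + (x - ?p) \<bullet> (y - ?p) - ph y \<le> t * (?B / 2)" if t: "0 < t" "t \<le> 1" for t
  proof -
    let ?z = "(1 - t) *\<^sub>R ?p + t *\<^sub>R y"
    have zd: "?z \<in> effdom \<phi>" using phi_convex(1)[OF pd y] t by simp
    have "ph ?p + (norm (?p - x))\<^sup>2 / 2 \<le> ph ?z + (norm (?z - x))\<^sup>2 / 2"
      using prox_minimizes[of x ?z] phi_eq[OF pd] phi_eq[OF zd]
      by (metis ereal_less_eq(3) plus_ereal.simps(1))
    moreover have "ph ?z \<le> (1 - t) * ph ?p + t * ph y" using phi_convex(2)[OF pd y] t by simp
    moreover have "?z - x = (?p - x) + t *\<^sub>R (y - ?p)" by (simp add: algebra_simps)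
    then have "(norm (?z - x))\<^sup>2 = (norm (?p - x))\<^sup>2 + 2 * t * ((?p - x) \<bullet> (y - ?p)) + t * t * ?B"
      by (simp add: power2_norm_eq_inner inner_add inner_commute algebra_simps)
    ultimately have "t * (ph ?p + (x - ?p) \<bullet> (y - ?p) - ph y) \<le> t * (t * (?B / 2))"
      by (simp add: algebra_simps inner_diff_left)
    then show ?thesis using t by (simp add: mult_le_cancel_left_pos)
  qed
  have "((\<lambda>t. t * (?B / 2)) \<longlongrightarrow> 0 * (?B / 2)) (at_right 0)" by (intro tendsto_intros)
  moreover have "eventually (\<lambda>t. ph ?p + (x - ?p) \<bullet> (y - ?p) - ph y \<le> t * (?B / 2)) (at_right 0)"
    unfolding eventually_at_right_field using key by (intro exI[of _ 1]) auto
  ultimately have "ph ?p + (x - ?p) \<bullet> (y - ?p) - ph y \<le> 0 * (?B / 2)"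
    by (intro tendsto_lowerbound[where F = "at_right 0"]) auto
  then show "ph ?p + (x - ?p) \<bullet> (y - ?p) \<le> ph y" by simp
qed

lemma subdifferential_monotone:
  assumes "u \<in> subdifferential \<phi> x" "v \<in> subdifferential \<phi> y"
  shows "0 \<le> (u - v) \<bullet> (x - y)"
proof -
  have "ph x + u \<bullet> (y - x) \<le> ph y" "ph y + v \<bullet> (x - y) \<le> ph x"
    using assms by (auto simp: subdifferential_iff)
  then show ?thesis by (simp add: algebra_simps inner_diff_left inner_diff_right)
qed

text \<open>Monotonicity of the subdifferential gives firm nonexpansiveness, from which
  Cauchy-Schwarz removes one factor.\<close>

lemma prox_nonexpansive: "norm (prox \<phi> x - prox \<phi> y) \<le> norm (x - y)"
proof -
  let ?p = "prox \<phi> x - prox \<phi> y"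
  have "0 \<le> ((x - prox \<phi> x) - (y - prox \<phi> y)) \<bullet> ?p"
    by (intro subdifferential_monotone prox_subgradient)
  then have "?p \<bullet> ?p \<le> (x - y) \<bullet> ?p" by (simp add: algebra_simps inner_diff_left inner_diff_right)
  also have "\<dots> \<le> norm (x - y) * norm ?p" by (rule norm_cauchy_schwarz)
  finally have "norm ?p * norm ?p \<le> norm (x - y) * norm ?p"
    by (simp add: power2_norm_eq_inner[symmetric] power2_eq_square)
  then show ?thesis by (cases "norm ?p = 0") auto
qed

lemma prox_fixed:
  assumes "v \<in> subdifferential \<phi> z"
  shows "prox \<phi> (z + v) = z"
proof -
  let ?p = "prox \<phi> (z + v)"
  have "0 \<le> (z + v - ?p - v) \<bullet> (?p - z)"
    by (intro subdifferential_monotone prox_subgradient assms)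
  then have "(?p - z) \<bullet> (?p - z) \<le> 0" by (simp add: algebra_simps inner_diff_left inner_diff_right)
  then show ?thesis by (metis eq_iff_diff_eq_0 inner_eq_zero_iff inner_ge_zero order_antisym)
qed

end

section \<open>The smooth part of the objective\<close>

lemma inner_transpose: "u \<bullet> (transpose B *v w) = (B *v u) \<bullet> w"
  for B :: "real ^ 'n ^ 'm"
  by (metis dot_lmul_matrix inner_commute vector_transpose_matrix)

sublocale composite_problem \<subseteq> proper_convex \<phi>
  by unfold_locales (rule proper_phi lsc_phi convex_phi)+

context composite_problem
begin

abbreviation "rf y \<equiv> real_of_ereal (smooth_part y)"

lemma smooth_domain:
  obtains U where "open U" "\<And>x. x \<in> effdom \<phi> \<Longrightarrow> A *v x - b \<in> U"
    "\<And>z. z \<in> U \<Longrightarrow> \<psi> z = ereal (real_of_ereal (\<psi> z))"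
    "\<And>z. z \<in> U \<Longrightarrow> (\<lambda>z. real_of_ereal (\<psi> z)) differentiable (at z)"
    "\<And>z. z \<in> U \<Longrightarrow> gradient (\<lambda>z. real_of_ereal (\<psi> z)) differentiable (at z)"
proof -
  obtain \<Omega> U where U: "effdom \<phi> \<subseteq> \<Omega>" "(\<lambda>x. A *v x - b) ` \<Omega> \<subseteq> U" "\<forall>z\<in>U. \<psi> z < \<infinity>"
    "C2_on U (\<lambda>z. real_of_ereal (\<psi> z))"
    using smoothness by blast
  have "\<psi> z = ereal (real_of_ereal (\<psi> z))" if "z \<in> U" for z
    using U(3) proper_psi that by (cases "\<psi> z") (auto simp: proper_def)
  moreover have "A *v x - b \<in> U" if "x \<in> effdom \<phi>" for x using U(1,2) that by blast
  ultimately show ?thesis using U(4) that[of U]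
    by (auto simp: C2_on_def differentiable_on_eq_differentiable_at)
qed

text \<open>Chain rule through the affine map. The preimage \<open>?V\<close> of \<open>U\<close> is
  open, so the formula for \<open>grad_f\<close> holds on a full neighbourhood of \<open>x\<close>
  and may be differentiated once more.\<close>

lemma smooth_part_derivatives:
  assumes "x \<in> effdom \<phi>"
  shows "(rf has_derivative (\<lambda>h. h \<bullet> grad_f x)) (at x)"
    and "(grad_f has_derivative (\<lambda>h. hess_f x *v h)) (at x)"
    and "hess_f x = transpose A ** hess_psi_at x ** A"
    and "smooth_part x = ereal (rf x)"
    and "u \<bullet> (hess_psi_at x *v v) = v \<bullet> (hess_psi_at x *v u)"
proof -
  let ?g = "\<lambda>z. real_of_ereal (\<psi> z)"
  obtain U where U: "open U" "A *v x - b \<in> U"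
    "\<And>z. z \<in> U \<Longrightarrow> \<psi> z = ereal (?g z)"
    "\<And>z. z \<in> U \<Longrightarrow> ?g differentiable (at z)"
    "\<And>z. z \<in> U \<Longrightarrow> gradient ?g differentiable (at z)"
    using smooth_domain assms by metis
  let ?V = "(\<lambda>x. A *v x - b) -` U"
  have affine: "((\<lambda>x. A *v x - b) has_derivative (\<lambda>h. A *v h)) (at y)" for y
    by (auto intro!: derivative_eq_intros bounded_linear_imp_has_derivative)
  have V: "open ?V"
    by (intro open_vimage U(1) continuous_intros linear_continuous_on matrix_vector_mul_bounded_linear)
  have rf: "rf = (\<lambda>y. ?g (A *v y - b))" by (simp add: smooth_part_def fun_eq_iff)
  have der: "(rf has_derivative (\<lambda>h. h \<bullet> (transpose A *v gradient ?g (A *v y - b)))) (at y)"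
    if "y \<in> ?V" for y
  proof -
    have "(?g has_derivative (\<lambda>h. h \<bullet> gradient ?g (A *v y - b))) (at (A *v y - b))"
      using that by (intro gradient_works U(4)) simp
    from has_derivative_compose[OF affine this] show ?thesis
      by (simp add: rf inner_transpose del: transpose_matrix_vector)
  qed
  have grad: "grad_f y = transpose A *v gradient ?g (A *v y - b)" if "y \<in> ?V" for y
    unfolding grad_f_def by (rule gradient_eqI[OF der[OF that]])
  have xV: "x \<in> ?V" using U(2) by simp
  show "(rf has_derivative (\<lambda>h. h \<bullet> grad_f x)) (at x)"
    using der[OF xV] grad[OF xV] by simp
  let ?M = "transpose A ** hess_psi_at x ** A"
  have "(gradient ?g has_derivative (\<lambda>h. hess_psi_at x *v h)) (at (A *v x - b))"
    unfolding hess_psi_at_def by (intro hessian_works U(5) U(2))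
  from has_derivative_compose[OF affine this]
  have "((\<lambda>y. transpose A *v gradient ?g (A *v y - b)) has_derivative
      (\<lambda>h. transpose A *v (hess_psi_at x *v (A *v h)))) (at x)"
    by (rule bounded_linear.has_derivative[OF matrix_vector_mul_bounded_linear])
  then have "((\<lambda>y. transpose A *v gradient ?g (A *v y - b)) has_derivative (\<lambda>h. ?M *v h)) (at x)"
    by (simp add: matrix_vector_mul_assoc matrix_mul_assoc)
  then have H: "(grad_f has_derivative (\<lambda>h. ?M *v h)) (at x)"
    by (rule has_derivative_transform_within_open[OF _ V xV]) (simp add: grad)
  have gf: "gradient rf = grad_f" by (simp add: grad_f_def fun_eq_iff)
  show hf: "hess_f x = ?M" unfolding hess_f_def by (rule hessian_eqI) (use H gf in simp)
  show "(grad_f has_derivative (\<lambda>h. hess_f x *v h)) (at x)" using H hf by simp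
  show "smooth_part x = ereal (rf x)" using U(3)[OF U(2)] by (simp add: smooth_part_def)
  show "u \<bullet> (hess_psi_at x *v v) = v \<bullet> (hess_psi_at x *v u)"
    unfolding hess_psi_at_def by (rule hessian_symmetric[OF U(1,2)]) (use U in auto)
qed

lemma inner_hess_f:
  assumes "x \<in> effdom \<phi>"
  shows "u \<bullet> (hess_f x *v v) = (A *v u) \<bullet> (hess_psi_at x *v (A *v v))"
  unfolding smooth_part_derivatives(3)[OF assms]
  by (simp add: inner_transpose del: transpose_matrix_vector flip: matrix_vector_mul_assoc)

lemma hess_f_symmetric:
  assumes "x \<in> effdom \<phi>"
  shows "u \<bullet> (hess_f x *v v) = v \<bullet> (hess_f x *v u)"
  by (simp add: inner_hess_f[OF assms] smooth_part_derivatives(5)[OF assms])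

lemma objective_eq:
  assumes "x \<in> effdom \<phi>"
  shows "objective x = ereal (rf x + ph x)"
  unfolding objective_def using smooth_part_derivatives(4)[OF assms] phi_eq[OF assms]
  by (metis plus_ereal.simps(1))

lemma model_eq:
  assumes "z \<in> effdom \<phi>" "y \<in> effdom \<phi>"
  shows "model M z y = ereal (rf z + (grad_f z \<bullet> (y - z) + (y - z) \<bullet> (M *v (y - z)) / 2) + ph y)"
  unfolding model_def using smooth_part_derivatives(4)[OF assms(1)] phi_eq[OF assms(2)]
  by (metis plus_ereal.simps(1))

lemma stationary_iff: "stationary x \<longleftrightarrow> - grad_f x \<in> subdifferential \<phi> x"
proof
  assume "stationary x"
  then obtain v where "v \<in> subdifferential \<phi> x" "0 = grad_f x + v"
    by (auto simp: stationary_def)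
  then show "- grad_f x \<in> subdifferential \<phi> x" by (metis neg_eq_iff_add_eq_0)
next
  assume "- grad_f x \<in> subdifferential \<phi> x"
  then show "stationary x"
    by (auto simp: stationary_def subdifferential_iff intro!: image_eqI[of _ _ "- grad_f x"])
qed

lemma residual_stationary: "stationary x \<Longrightarrow> residual x = 0"
  using prox_fixed[of "- grad_f x" x] by (simp add: stationary_iff residual_def)

text \<open>Follows from nonexpansiveness of \<open>prox\<close>. With a stationary \<open>y\<close>
  it bounds the residual at \<open>x\<close> by the distance to \<open>y\<close>.\<close>

lemma residual_difference:
  "norm (residual x - residual y) \<le> 2 * norm (x - y) + norm (grad_f x - grad_f y)"
proof -
  let ?p = "prox \<phi> (x - grad_f x) - prox \<phi> (y - grad_f y)"
  have "norm (residual x - residual y) = norm ((x - y) - ?p)"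
    by (simp add: residual_def algebra_simps)
  also have "\<dots> \<le> norm (x - y) + norm ?p" by (rule norm_triangle_ineq4)
  also have "norm ?p \<le> norm ((x - grad_f x) - (y - grad_f y))" by (rule prox_nonexpansive)
  also have "\<dots> = norm ((x - y) - (grad_f x - grad_f y))" by (simp add: algebra_simps)
  also have "\<dots> \<le> norm (x - y) + norm (grad_f x - grad_f y)" by (rule norm_triangle_ineq4)
  finally show ?thesis by simp
qed

text \<open>At its centre the model residual is the true residual, so this limits how far the
  residual can be reduced by a short step; it later yields a lower bound on the step length.\<close>

lemma model_residual_difference:
  "norm (model_residual M z x - model_residual M z y) \<le> 2 * norm (x - y) + norm (M *v (x - y))"
proof -
  let ?p = "prox \<phi> (x - grad_f z - M *v (x - z)) - prox \<phi> (y - grad_f z - M *v (y - z))"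
  have "norm (model_residual M z x - model_residual M z y) = norm ((x - y) - ?p)"
    by (simp add: model_residual_def algebra_simps)
  also have "\<dots> \<le> norm (x - y) + norm ?p" by (rule norm_triangle_ineq4)
  also have "norm ?p \<le> norm ((x - grad_f z - M *v (x - z)) - (y - grad_f z - M *v (y - z)))"
    by (rule prox_nonexpansive)
  also have "\<dots> = norm ((x - y) - M *v (x - y))"
    by (simp add: algebra_simps)
  also have "\<dots> \<le> norm (x - y) + norm (M *v (x - y))" by (rule norm_triangle_ineq4)
  finally show ?thesis by simp
qed

lemma residual_eq_model_residual: "residual x = model_residual M x x"
  by (simp add: residual_def model_residual_def)

text \<open>The two arguments of \<open>prox\<close> differ exactly by the linearization error of
  the gradient.\<close>

lemma residual_model_residual:
  "norm (residual y - model_residual M x y) \<le> norm (grad_f y - grad_f x - M *v (y - x))"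
proof -
  have "norm (residual y - model_residual M x y)
      = norm (prox \<phi> (y - grad_f x - M *v (y - x)) - prox \<phi> (y - grad_f y))"
    by (simp add: residual_def model_residual_def)
  also have "\<dots> \<le> norm ((y - grad_f x - M *v (y - x)) - (y - grad_f y))"
    by (rule prox_nonexpansive)
  finally show ?thesis by (simp add: algebra_simps)
qed

end

lemma norm_matrix_diff_le_spectral:
  "norm (M *v w - N *v w) \<le> spectral_norm (M - N) * norm w"
proof -
  have "norm ((M - N) *v w) \<le> spectral_norm (M - N) * norm w"
    unfolding spectral_norm_def by (rule onorm[OF matrix_vector_mul_bounded_linear])
  then show ?thesis by (simp add: matrix_vector_mult_diff_rdistrib)
qed

section \<open>Uniform Taylor and perturbation bounds near the limit point\<close>

context composite_problem
begin

text \<open>The Lipschitz Hessian of \<open>\<psi>\<close> passes through \<open>A\<close> to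
  \<open>hess_f\<close>. Segments between points of the ball within the domain stay there by
  convexity, so the mean value inequality applies. A single \<open>C\<close> dominates all the
  constants.\<close>

lemma local_bounds:
  assumes xstar: "xstar \<in> effdom \<phi>" and eps: "0 < \<epsilon>" and L: "0 < L"
    and lip: "\<And>u v. u \<in> cball xstar \<epsilon> \<inter> effdom \<phi> \<Longrightarrow> v \<in> cball xstar \<epsilon> \<inter> effdom \<phi> \<Longrightarrow>
          spectral_norm (hess_psi_at u - hess_psi_at v) \<le> L * norm (A *v u - A *v v)"
  obtains C where "1 \<le> C"
    and "\<And>w. norm (transpose A *v (A *v w)) \<le> C * norm w"
    and "\<And>u w. u \<in> cball xstar \<epsilon> \<inter> effdom \<phi> \<Longrightarrow> norm (hess_f u *v w) \<le> C * norm w"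
    and "\<And>u v. u \<in> cball xstar \<epsilon> \<inter> effdom \<phi> \<Longrightarrow> v \<in> cball xstar \<epsilon> \<inter> effdom \<phi> \<Longrightarrow>
          norm (grad_f v - grad_f u - hess_f u *v (v - u)) \<le> C * (norm (v - u))\<^sup>2"
    and "\<And>u v. u \<in> cball xstar \<epsilon> \<inter> effdom \<phi> \<Longrightarrow> v \<in> cball xstar \<epsilon> \<inter> effdom \<phi> \<Longrightarrow>
          \<bar>rf v - rf u - grad_f u \<bullet> (v - u) - (v - u) \<bullet> (hess_f u *v (v - u)) / 2\<bar>
            \<le> C * (norm (v - u)) ^ 3"
    and "\<And>u v. u \<in> cball xstar \<epsilon> \<inter> effdom \<phi> \<Longrightarrow> v \<in> cball xstar \<epsilon> \<inter> effdom \<phi> \<Longrightarrow>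
          norm (grad_f u - grad_f v) \<le> C * norm (u - v)"
    and "\<And>u v. u \<in> cball xstar \<epsilon> \<inter> effdom \<phi> \<Longrightarrow> v \<in> cball xstar \<epsilon> \<inter> effdom \<phi> \<Longrightarrow>
          psd (hess_psi_at v) \<Longrightarrow> max 0 (- lambda_min (hess_psi_at u)) \<le> C * norm (u - v)"
proof -
  let ?N = "cball xstar \<epsilon> \<inter> effdom \<phi>"
  have N: "convex ?N" by (intro convex_Int convex_cball convex_effdom)
  have xN: "xstar \<in> ?N" using xstar eps by simp
  define K where "K = onorm ((*v) A) + onorm ((*v) (transpose A)) + 1"
  have on: "0 \<le> onorm ((*v) A)" "0 \<le> onorm ((*v) (transpose A))"
    by (rule onorm_pos_le[OF matrix_vector_mul_bounded_linear])+
  then have K: "1 \<le> K" by (simp add: K_def)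
  have A: "norm (A *v w) \<le> K * norm w" for w
    using on
    by (intro order_trans[OF onorm[OF matrix_vector_mul_bounded_linear]] mult_right_mono)
      (auto simp: K_def)
  have At: "norm (transpose A *v w) \<le> K * norm w" for w
    using on
    by (intro order_trans[OF onorm[OF matrix_vector_mul_bounded_linear]] mult_right_mono)
      (auto simp: K_def)
  define KL where "KL = L * K"
  have KL0: "0 \<le> KL" using L K by (simp add: KL_def)
  have KL: "norm (hess_psi_at u *v w - hess_psi_at v *v w) \<le> KL * norm (u - v) * norm w"
    if "u \<in> ?N" "v \<in> ?N" for u v w
  proof -
    have "norm (hess_psi_at u *v w - hess_psi_at v *v w)
        \<le> spectral_norm (hess_psi_at u - hess_psi_at v) * norm w"
      by (rule norm_matrix_diff_le_spectral)
    also have "\<dots> \<le> (L * norm (A *v u - A *v v)) * norm w"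
      using lip[OF that] by (intro mult_right_mono) auto
    also have "\<dots> \<le> (L * (K * norm (u - v))) * norm w"
      using A[of "u - v"] L
      by (intro mult_right_mono mult_left_mono) (auto simp: matrix_vector_mult_diff_distrib)
    finally show ?thesis by (simp add: KL_def mult.assoc)
  qed
  \<comment> \<open>The norm of the Hessian at the centre plus its largest variation over the
    ball.\<close>
  define KH where "KH = onorm ((*v) (hess_psi_at xstar)) + KL * \<epsilon>"
  have KH0: "0 \<le> KH"
    using onorm_pos_le[OF matrix_vector_mul_bounded_linear, of "hess_psi_at xstar"] KL0 eps
    by (simp add: KH_def)
  have KH: "norm (hess_psi_at u *v w) \<le> KH * norm w" if u: "u \<in> ?N" for u w
  proof -
    have "norm (hess_psi_at u *v w) \<le> norm (hess_psi_at xstar *v w)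
        + norm (hess_psi_at u *v w - hess_psi_at xstar *v w)" by (rule norm_triangle_sub)
    also have "\<dots> \<le> onorm ((*v) (hess_psi_at xstar)) * norm w + KL * \<epsilon> * norm w"
    proof (rule add_mono)
      show "norm (hess_psi_at xstar *v w) \<le> onorm ((*v) (hess_psi_at xstar)) * norm w"
        by (rule onorm[OF matrix_vector_mul_bounded_linear])
      have "norm (u - xstar) \<le> \<epsilon>" using u by (simp add: dist_norm norm_minus_commute)
      then have "KL * norm (u - xstar) * norm w \<le> KL * \<epsilon> * norm w"
        using KL0 by (intro mult_right_mono mult_left_mono) auto
      then show "norm (hess_psi_at u *v w - hess_psi_at xstar *v w) \<le> KL * \<epsilon> * norm w"
        using KL[OF u xN, of w] by linarith
    qed
    finally show ?thesis by (simp add: KH_def algebra_simps)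
  qed
  have hess: "hess_f u *v w = transpose A *v (hess_psi_at u *v (A *v w))" if "u \<in> ?N" for u w
    using smooth_part_derivatives(3)[of u] that by (simp add: matrix_vector_mul_assoc matrix_mul_assoc del: transpose_matrix_vector)
  define KF where "KF = K * (KH * K)"
  have KF0: "0 \<le> KF" using K KH0 by (simp add: KF_def)
  have KF: "norm (hess_f u *v w) \<le> KF * norm w" if u: "u \<in> ?N" for u w
  proof -
    have "norm (hess_f u *v w) \<le> K * norm (hess_psi_at u *v (A *v w))"
      unfolding hess[OF u] by (rule At)
    also have "\<dots> \<le> K * (KH * norm (A *v w))" using K by (intro mult_left_mono KH u) auto
    also have "\<dots> \<le> K * (KH * (K * norm w))" using K KH0 by (intro mult_left_mono A) auto
    finally show ?thesis by (simp add: KF_def mult.assoc)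
  qed
  define LH where "LH = K * (KL * K)"
  have LH0: "0 \<le> LH" using K KL0 by (simp add: LH_def)
  have LH: "norm (hess_f u *v w - hess_f v *v w) \<le> LH * norm (u - v) * norm w"
    if "u \<in> ?N" "v \<in> ?N" for u v w
  proof -
    have "norm (hess_f u *v w - hess_f v *v w)
        \<le> K * norm (hess_psi_at u *v (A *v w) - hess_psi_at v *v (A *v w))"
      unfolding hess[OF that(1)] hess[OF that(2)] matrix_vector_mult_diff_distrib[symmetric] by (rule At)
    also have "\<dots> \<le> K * (KL * norm (u - v) * norm (A *v w))"
      using K by (intro mult_left_mono KL that) auto
    also have "\<dots> \<le> K * (KL * norm (u - v) * (K * norm w))"
      using K KL0 by (intro mult_left_mono A) auto
    finally show ?thesis by (simp add: LH_def algebra_simps)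
  qed
  have seg: "closed_segment u v \<subseteq> ?N" if "u \<in> ?N" "v \<in> ?N" for u v
    using N that by (rule closed_segment_subset[rotated 2])
  \<comment> \<open>On the segment the Hessian deviates from its value at \<open>u\<close> by at
    most \<open>LH * norm (v - u)\<close>; the sharp factor 1/2 is given up.\<close>
  have taylor1: "norm (grad_f v - grad_f u - hess_f u *v (v - u)) \<le> LH * (norm (v - u))\<^sup>2"
    if uv: "u \<in> ?N" "v \<in> ?N" for u v
  proof -
    have "norm (grad_f v - grad_f u - hess_f u *v (v - u)) \<le> norm (v - u) * (LH * norm (v - u))"
    proof (rule differentiable_bound_linearization[where S = "closed_segment u v"
          and f' = "\<lambda>y h. hess_f y *v h"])
      show "u + t *\<^sub>R (v - u) \<in> closed_segment u v" if "t \<in> {0..1}" for t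
        unfolding in_segment using that
        by (intro exI[of _ t]) (simp add: scaleR_diff_left scaleR_diff_right)
      fix y assume y: "y \<in> closed_segment u v"
      then have yN: "y \<in> ?N" using seg[OF uv] by blast
      then show "(grad_f has_derivative (\<lambda>h. hess_f y *v h)) (at y within closed_segment u v)"
        by (intro has_derivative_at_withinI[OF smooth_part_derivatives(2)]) simp
      have "norm (y - u) \<le> norm (v - u)" using segment_bound1[OF y] by simp
      then have le: "LH * norm (y - u) * norm h \<le> LH * norm (v - u) * norm h" for h :: "real^'n"
        using LH0 by (intro mult_right_mono mult_left_mono) auto
      have "norm (hess_f y *v h - hess_f u *v h) \<le> LH * norm (v - u) * norm h" for h
        using LH[OF yN uv(1), of h] le[of h] by linarith
      then show "onorm ((\<lambda>h. hess_f y *v h) - (\<lambda>h. hess_f u *v h)) \<le> LH * norm (v - u)"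
        by (intro onorm_le) simp
    qed simp
    then show ?thesis by (simp add: power2_eq_square mult.left_commute)
  qed
  have taylor2: "\<bar>rf v - rf u - grad_f u \<bullet> (v - u) - (v - u) \<bullet> (hess_f u *v (v - u)) / 2\<bar>
      \<le> LH * (norm (v - u)) ^ 3" if uv: "u \<in> ?N" "v \<in> ?N" for u v
  proof -
    \<comment> \<open>Subtracting the linear and quadratic Taylor terms leaves a function whose
      gradient is the remainder of \<open>taylor1\<close>; symmetry of the Hessian enters when the
      quadratic term is differentiated.\<close>
    define h where "h y = rf y - grad_f u \<bullet> (y - u) - (y - u) \<bullet> (hess_f u *v (y - u)) / 2" for y
    have "norm (h v - h u) \<le> LH * (norm (v - u))\<^sup>2 * norm (v - u)"
    proof (rule differentiable_bound[where S = "closed_segment u v"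
          and f' = "\<lambda>y k. k \<bullet> (grad_f y - grad_f u - hess_f u *v (y - u))"])
      fix y assume y: "y \<in> closed_segment u v"
      then have yN: "y \<in> ?N" using seg[OF uv] by blast
      have "((\<lambda>y. hess_f u *v (y - u)) has_derivative (\<lambda>k. hess_f u *v (k - 0))) (at y)"
        by (intro bounded_linear.has_derivative[OF matrix_vector_mul_bounded_linear] derivative_intros)
      then have lin: "((\<lambda>y. hess_f u *v (y - u)) has_derivative (\<lambda>k. hess_f u *v k)) (at y)" by simp
      have "(h has_derivative (\<lambda>k. k \<bullet> grad_f y - grad_f u \<bullet> (k - 0)
          - ((y - u) \<bullet> (hess_f u *v k) + (k - 0) \<bullet> (hess_f u *v (y - u))) / 2)) (at y)"
        unfolding h_def using yN
        by (intro has_derivative_diff has_derivative_inner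
            has_derivative_inner_right has_derivative_ident has_derivative_const lin
            smooth_part_derivatives(1) bounded_linear.has_derivative[OF bounded_linear_divide]) auto
      moreover have "(y - u) \<bullet> (hess_f u *v k) = k \<bullet> (hess_f u *v (y - u))" for k
        using hess_f_symmetric uv by blast
      ultimately have "(h has_derivative (\<lambda>k. k \<bullet> (grad_f y - grad_f u - hess_f u *v (y - u)))) (at y)"
        by (simp add: inner_diff_right inner_commute)
      then show "(h has_derivative (\<lambda>k. k \<bullet> (grad_f y - grad_f u - hess_f u *v (y - u))))
          (at y within closed_segment u v)" by (rule has_derivative_at_withinI)
      have "norm (grad_f y - grad_f u - hess_f u *v (y - u)) \<le> LH * (norm (y - u))\<^sup>2"
        by (rule taylor1[OF uv(1) yN])
      also have "\<dots> \<le> LH * (norm (v - u))\<^sup>2"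
        using LH0 segment_bound1[OF y] by (intro mult_left_mono power_mono) auto
      finally have le: "norm (grad_f y - grad_f u - hess_f u *v (y - u)) \<le> LH * (norm (v - u))\<^sup>2" .
      show "onorm (\<lambda>k. k \<bullet> (grad_f y - grad_f u - hess_f u *v (y - u))) \<le> LH * (norm (v - u))\<^sup>2"
      proof (rule onorm_le)
        fix k :: "real^'n"
        have "norm (k \<bullet> (grad_f y - grad_f u - hess_f u *v (y - u)))
            \<le> norm k * norm (grad_f y - grad_f u - hess_f u *v (y - u))"
          using Cauchy_Schwarz_ineq2 by auto
        also have "\<dots> \<le> norm k * (LH * (norm (v - u))\<^sup>2)" using le by (intro mult_left_mono) auto
        finally show "norm (k \<bullet> (grad_f y - grad_f u - hess_f u *v (y - u)))
            \<le> LH * (norm (v - u))\<^sup>2 * norm k" by (simp add: mult.commute)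
      qed
    qed auto
    then show ?thesis by (simp add: h_def power3_eq_cube power2_eq_square algebra_simps)
  qed
  define KG where "KG = KF + LH * (2 * \<epsilon>)"
  have KG0: "0 \<le> KG" using KF0 LH0 eps by (simp add: KG_def)
  have KG: "norm (grad_f u - grad_f v) \<le> KG * norm (u - v)" if uv: "u \<in> ?N" "v \<in> ?N" for u v
  proof -
    have "norm (u - v) \<le> 2 * \<epsilon>"
      using uv dist_triangle2[of u v xstar] by (simp add: dist_norm[symmetric] dist_commute)
    then have "LH * norm (u - v) * norm (u - v) \<le> LH * (2 * \<epsilon>) * norm (u - v)"
      using LH0 by (intro mult_right_mono mult_left_mono) auto
    moreover have "norm (grad_f u - grad_f v) \<le> norm (hess_f v *v (u - v))
        + norm (grad_f u - grad_f v - hess_f v *v (u - v))" by (rule norm_triangle_sub)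
    ultimately show ?thesis using KF[OF uv(2), of "u - v"] taylor1[OF uv(2,1)]
      by (simp add: KG_def power2_eq_square algebra_simps)
  qed
  have lam: "max 0 (- lambda_min (hess_psi_at u)) \<le> KL * norm (u - v)"
    if uv: "u \<in> ?N" "v \<in> ?N" and psd: "psd (hess_psi_at v)" for u v
  proof -
    let ?l = "lambda_min (hess_psi_at u)"
    have "real_eigenvalue (hess_psi_at u) ?l"
      using smooth_part_derivatives(5) uv by (intro symmetric_least_eigenvalue) blast
    then obtain w where w: "w \<noteq> 0" "hess_psi_at u *v w = ?l *\<^sub>R w" by (auto simp: real_eigenvalue_def)
    \<comment> \<open>An eigenvector for the least eigenvalue at \<open>u\<close> tests positive
      semidefiniteness at \<open>v\<close>, so a negative eigenvalue is no larger in modulus than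
      the change of the Hessian.\<close>
    have "w \<bullet> (hess_psi_at v *v w - hess_psi_at u *v w) \<le> norm w * norm (hess_psi_at v *v w - hess_psi_at u *v w)"
      by (rule norm_cauchy_schwarz)
    also have "\<dots> \<le> norm w * (KL * norm (v - u) * norm w)"
      by (intro mult_left_mono KL uv) auto
    finally have "- ?l * (norm w)\<^sup>2 \<le> (KL * norm (u - v)) * (norm w)\<^sup>2"
      using psd[unfolded psd_def, rule_format, of w] w
      by (simp add: inner_diff_right power2_norm_eq_inner[symmetric] norm_minus_commute power2_eq_square algebra_simps)
    then have "- ?l \<le> KL * norm (u - v)" using w(1) by (subst (asm) mult_le_cancel_right_pos) auto
    then show ?thesis using KL0 by simp
  qed
  define C where "C = 1 + K * K + KF + LH + KG + KL"
  have C: "1 \<le> C" "K * K \<le> C" "KF \<le> C" "LH \<le> C" "KG \<le> C" "KL \<le> C"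
    using K KF0 LH0 KG0 KL0 by (auto simp: C_def intro: add_nonneg_nonneg)
  have up: "X \<le> c * y \<Longrightarrow> c \<le> C \<Longrightarrow> 0 \<le> y \<Longrightarrow> X \<le> C * y" for X c y :: real
    by (meson mult_right_mono order_trans)
  show ?thesis
  proof (rule that[OF C(1)])
    fix w
    have "norm (transpose A *v (A *v w)) \<le> K * norm (A *v w)" by (rule At)
    also have "\<dots> \<le> K * (K * norm w)" using K by (intro mult_left_mono A) auto
    finally show "norm (transpose A *v (A *v w)) \<le> C * norm w"
      using up[of _ "K * K"] C by (simp add: mult.assoc)
  next
    fix u w assume "u \<in> ?N"
    then show "norm (hess_f u *v w) \<le> C * norm w" using up[OF KF C(3)] by simp
  next
    fix u v assume uv: "u \<in> ?N" "v \<in> ?N"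
    show "norm (grad_f v - grad_f u - hess_f u *v (v - u)) \<le> C * (norm (v - u))\<^sup>2"
      by (rule up[OF taylor1[OF uv] C(4)]) simp
    show "\<bar>rf v - rf u - grad_f u \<bullet> (v - u) - (v - u) \<bullet> (hess_f u *v (v - u)) / 2\<bar>
            \<le> C * (norm (v - u)) ^ 3"
      by (rule up[OF taylor2[OF uv] C(4)]) simp
    show "norm (grad_f u - grad_f v) \<le> C * norm (u - v)" by (rule up[OF KG[OF uv] C(5)]) simp
    show "max 0 (- lambda_min (hess_psi_at u)) \<le> C * norm (u - v)" if "psd (hess_psi_at v)"
      by (rule up[OF lam[OF uv that] C(6)]) simp
  qed
qed

end

section \<open>Iterates of the method\<close>

text \<open>The common form of the smallness thresholds below; finitely many of them combine into
  one bound on the residual.\<close>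

lemma eventually_mult_powr_less:
  fixes K p c :: real
  assumes "0 < p" "0 < c"
  shows "eventually (\<lambda>t. K * t powr p < c) (at_right 0)"
proof -
  have "((\<lambda>t::real. t powr p) \<longlongrightarrow> 0 powr p) (at_right 0)"
    by (intro tendsto_powr' tendsto_ident_at tendsto_const)
      (use assms in \<open>auto simp: eventually_at_filter\<close>)
  from tendsto_mult[OF tendsto_const[of K] this]
  have "((\<lambda>t. K * t powr p) \<longlongrightarrow> 0) (at_right 0)" by simp
  then show ?thesis using assms(2) by (rule order_tendstoD(2))
qed

context rpn_method
begin

text \<open>Outside the domain \<open>qhat\<close> would be infinite, contradicting the real lower
  bound in \<open>inexact_decrease\<close>. Hence trial points, and with them all iterates, remain
  in the domain.\<close>

lemma iterate_effdom: "x k \<in> effdom \<phi>"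
  and xhat_effdom: "xhat k \<in> effdom \<phi>"
proof -
  have xh: "xhat j \<in> effdom \<phi>" if xj: "x j \<in> effdom \<phi>" for j
  proof (rule ccontr)
    assume "xhat j \<notin> effdom \<phi>"
    then have "\<phi> (xhat j) = \<infinity>" by (rule phi_infinite)
    moreover obtain s where "smooth_part (x j) = ereal s"
      by (rule that[OF smooth_part_derivatives(4)[OF xj]])
    ultimately have "qhat j (xhat j) = \<infinity>" by (simp add: qhat_def model_def)
    then show False using inexact_decrease[of j] objective_eq[OF xj] by simp
  qed
  show x: "x k \<in> effdom \<phi>"
  proof (induction k)
    case (Suc k)
    then show ?case
      using xh[OF Suc] unsuccessful_step[of k] successful_step[of k] highly_successful_step[of k]
      by (cases "unsuccessful k"; cases "rho k \<le> ereal c\<^sub>2") (auto simp: not_le)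
  qed (rule start(1))
  show "xhat k \<in> effdom \<phi>" by (rule xh[OF x])
qed

lemma nu_lower: "\<nu>min \<le> \<nu> k"
proof (induction k)
  case 0
  show ?case by (rule nu_bounds(2))
next
  case (Suc k)
  have "\<nu> k \<le> \<sigma>\<^sub>2 * \<nu> k" using sigma2 Suc nu_bounds(1) by simp
  moreover have "\<nu>min \<le> \<nu>max" using nu_bounds by simp
  ultimately show ?case
    using Suc unsuccessful_step[of k] successful_step[of k] highly_successful_step[of k]
    by (cases "unsuccessful k"; cases "rho k \<le> ereal c\<^sub>2") (auto simp: not_le)
qed

text \<open>At a reset index \<open>rbar k = r k\<close>; otherwise \<open>rbar k\<close> is carried
  over from the failed test, and that failure is the claim.\<close>

lemma rbar_le_residual: "\<eta> * rbar k \<le> r k"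
  and rbar_reset: "k \<in> reset_indices \<Longrightarrow> rbar k = r k"
proof -
  have r0: "0 \<le> r j" for j by (simp add: r_def)
  show reset: "k \<in> reset_indices \<Longrightarrow> rbar k = r k" for k
    using rbar_step[of "k - 1"] start(2) by (auto simp: reset_indices_def r_def)
  show "\<eta> * rbar k \<le> r k"
  proof (cases "k \<in> reset_indices")
    case True
    then show ?thesis using reset[OF True] eta r0[of k] by (simp add: mult_left_le_one_le)
  next
    case False
    then obtain j where j: "k = Suc j" "r k > \<eta> * rbar j"
      by (cases k) (auto simp: reset_indices_def r_def not_le)
    then show ?thesis using rbar_step[of j] by simp
  qed
qed

text \<open>Unsuccessful steps may push \<open>\<nu>\<close> above \<open>\<nu>max\<close>, but a
  reset forces the iterate to have moved, so the preceding step was successful and truncated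
  \<open>\<nu>\<close>.\<close>

lemma nu_upper_reset:
  assumes k: "k \<in> reset_indices" and pos: "\<And>j. 0 < r j"
  shows "\<nu> k \<le> \<nu>max"
proof (cases k)
  case 0
  then show ?thesis using nu_bounds by simp
next
  case (Suc j)
  have "r k \<le> \<eta> * rbar j" using k Suc by (auto simp: reset_indices_def r_def)
  moreover have "\<eta> * rbar j \<le> r j" by (rule rbar_le_residual)
  \<comment> \<open>The inequality \<open>\<eta> * rbar j < r j\<close> is strict both at a reset
    index (as \<open>\<eta> < 1\<close>) and after a failed test, so a repeated iterate cannot pass
    the test.\<close>
  moreover have "r k \<noteq> \<eta> * rbar j" if "x k = x j"
  proof (cases "j \<in> reset_indices")
    case True
    then show ?thesis using rbar_reset[OF True] eta pos[of j] that by (simp add: r_def)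
  next
    case False
    then obtain i where i: "j = Suc i" "r j > \<eta> * rbar i"
      by (cases j) (auto simp: reset_indices_def r_def not_le)
    then show ?thesis using rbar_step[of i] that by (simp add: r_def)
  qed
  ultimately have "x k \<noteq> x j" by (auto simp: r_def)
  then have "\<not> unsuccessful j" using unsuccessful_step[of j] Suc by auto
  then show ?thesis using successful_step[of j] highly_successful_step[of j] Suc
    by (metis min.cobounded2 not_le)
qed

text \<open>At the vector \<open>A *v w\<close> the negative part of the least eigenvalue is
  outweighed by \<open>Lambda k\<close>, because \<open>1 \<le> a\<close>.\<close>

lemma H_psd: "0 \<le> w \<bullet> (H k *v w)"
proof -
  let ?l = "lambda_min (hess_psi_at (x k))" and ?y = "A *v w"
  have "?l * (norm ?y)\<^sup>2 \<le> ?y \<bullet> (hess_psi_at (x k) *v ?y)"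
    using smooth_part_derivatives(5)[OF iterate_effdom] by (rule symmetric_least_eigenvalue(2))
  moreover have "max 0 (- ?l) \<le> Lambda k"
    using mult_right_mono[OF a, of "max 0 (- ?l)"] by (simp add: Lambda_def)
  then have "- ?l \<le> Lambda k" by simp
  then have "- ?l * (norm ?y)\<^sup>2 \<le> Lambda k * (norm ?y)\<^sup>2" by (intro mult_right_mono) auto
  moreover have "w \<bullet> (H k *v w) = ?y \<bullet> (hess_psi_at (x k) *v ?y) + Lambda k * (norm ?y)\<^sup>2"
    by (simp add: H_def inner_hess_f[OF iterate_effdom] matrix_vector_mult_add_rdistrib inner_add_right
        inner_transpose power2_norm_eq_inner scaleR_matrix_vector_assoc[symmetric]
        del: transpose_matrix_vector flip: matrix_vector_mul_assoc)
  ultimately show ?thesis by simp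
qed

lemma Lambda_nonneg: "0 \<le> Lambda k"
  using a by (simp add: Lambda_def)

lemma G_apply:
  "G k *v w = hess_f (x k) *v w + Lambda k *\<^sub>R (transpose A *v (A *v w)) + mu k *\<^sub>R w"
  by (simp add: G_def H_def matrix_vector_mult_add_rdistrib scaleR_matrix_vector_assoc[symmetric]
        del: transpose_matrix_vector flip: matrix_vector_mul_assoc)

lemma G_lower: "mu k * (norm w)\<^sup>2 \<le> w \<bullet> (G k *v w)"
  using H_psd[of w k]
  by (simp add: G_def matrix_vector_mult_add_rdistrib inner_add_right power2_norm_eq_inner
      scaleR_matrix_vector_assoc[symmetric])

lemma pred_eq:
  "pred k = ereal (ph (x k) - ph (xhat k) - grad_f (x k) \<bullet> d k - d k \<bullet> (hess_f (x k) *v d k) / 2)"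
  by (simp add: pred_def q_def d_def objective_eq[OF iterate_effdom] model_eq[OF iterate_effdom xhat_effdom])

lemma ared_eq: "ared k = ereal (rf (x k) + ph (x k) - rf (xhat k) - ph (xhat k))"
  by (simp add: ared_def objective_eq[OF iterate_effdom] objective_eq[OF xhat_effdom])

text \<open>The decrease demanded of \<open>qhat\<close> is nonnegative, and \<open>q\<close> lies
  below \<open>qhat\<close> by half of \<open>Lambda k * (norm (A *v d k))\<^sup>2 + mu k * (norm (d
  k))\<^sup>2\<close>. Only the second term is kept.\<close>

lemma pred_lower:
  assumes "0 \<le> mu k"
  shows "mu k / 2 * (norm (d k))\<^sup>2
    \<le> ph (x k) - ph (xhat k) - grad_f (x k) \<bullet> d k - d k \<bullet> (hess_f (x k) *v d k) / 2"
proof -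
  have "\<alpha> * mu k / 2 * (norm (d k))\<^sup>2
      \<le> ph (x k) - ph (xhat k) - grad_f (x k) \<bullet> d k - d k \<bullet> (G k *v d k) / 2"
    using inexact_decrease[of k]
    by (simp add: qhat_def d_def objective_eq[OF iterate_effdom] model_eq[OF iterate_effdom xhat_effdom])
  moreover have "0 \<le> \<alpha> * mu k / 2 * (norm (d k))\<^sup>2" using assms alpha by simp
  moreover have "d k \<bullet> (G k *v d k) = d k \<bullet> (hess_f (x k) *v d k) + Lambda k * (norm (A *v d k))\<^sup>2
      + mu k * (norm (d k))\<^sup>2"
    by (simp add: G_apply inner_add_right inner_transpose power2_norm_eq_inner del: transpose_matrix_vector)
  moreover have "0 \<le> Lambda k * (norm (A *v d k))\<^sup>2" using Lambda_nonneg by simp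
  ultimately show ?thesis by linarith
qed

end

section \<open>Local convergence\<close>

text \<open>If \<open>W\<close> exceeded \<open>(K + Q) * S\<close>, multiplying by \<open>W\<close>
  and inserting the bound once more into the term with \<open>Q\<close> would contradict the
  hypothesis.\<close>

lemma quadratic_inequality_bound:
  fixes W S K Q :: real
  assumes "W * W \<le> K * S * W + K * Q * (S * S)" and nn: "0 \<le> W" "0 \<le> S" "0 \<le> K" "0 \<le> Q"
  shows "W \<le> (K + Q) * S"
proof (rule ccontr)
  assume "\<not> ?thesis"
  then have less: "(K + Q) * S < W" by simp
  moreover have "0 \<le> (K + Q) * S" using nn by simp
  ultimately have "0 < W" by linarith
  with less have "((K + Q) * S) * W < W * W" by simp
  moreover have "(Q * S) * ((K + Q) * S) \<le> (Q * S) * W" using nn less by (intro mult_left_mono) auto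
  moreover have "0 \<le> Q * Q * (S * S)" using nn by simp
  ultimately show False using assms(1) by (simp add: algebra_simps)
qed

context rpn_method
begin

text \<open>Monotonicity of the subdifferential, applied at the inexact minimizer shifted by its own
  residual and at a stationary point; the Taylor remainder of the gradient replaces the gradient
  difference.\<close>

lemma displacement_inequality:
  fixes k :: nat and xbar :: "real ^ 'n"
  assumes "stationary xbar"
  defines "bb \<equiv> (grad_f xbar - grad_f (x k) - hess_f (x k) *v (xbar - x k))
    + Lambda k *\<^sub>R (transpose A *v (A *v (x k - xbar))) + mu k *\<^sub>R (x k - xbar)"
  shows "mu k * (norm (xhat k - xbar))\<^sup>2
    \<le> (norm (R k (xhat k)) + norm bb) * norm (xhat k - xbar)
      + (norm (G k *v (xhat k - xbar)) + norm bb) * norm (R k (xhat k))"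
proof -
  define e where "e = R k (xhat k)"
  define w where "w = xhat k - xbar"
  have p: "prox \<phi> (xhat k - grad_f (x k) - G k *v (xhat k - x k)) = xhat k - e"
    by (simp add: e_def R_def model_residual_def)
  have "xhat k - grad_f (x k) - G k *v (xhat k - x k) - (xhat k - e) \<in> subdifferential \<phi> (xhat k - e)"
    using prox_subgradient[of "xhat k - grad_f (x k) - G k *v (xhat k - x k)"] unfolding p .
  then have "0 \<le> (xhat k - grad_f (x k) - G k *v (xhat k - x k) - (xhat k - e) - (- grad_f xbar))
      \<bullet> (xhat k - e - xbar)"
    using assms(1) unfolding stationary_iff by (rule subdifferential_monotone)
  \<comment> \<open>\<open>bb\<close> is the true gradient at \<open>xbar\<close> minus the model
    gradient there. Separating it leaves the trial point only in \<open>e\<close> and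
    \<open>G k *v w\<close>.\<close>
  also have "xhat k - grad_f (x k) - G k *v (xhat k - x k) - (xhat k - e) - (- grad_f xbar)
      = e + bb - G k *v w"
    unfolding bb_def w_def G_apply by (simp add: algebra_simps)
  also have "xhat k - e - xbar = w - e" by (simp add: w_def)
  finally have "w \<bullet> (G k *v w) \<le> e \<bullet> w + bb \<bullet> w + (G k *v w) \<bullet> e + (- bb) \<bullet> e - e \<bullet> e"
    by (simp add: inner_diff inner_add inner_commute algebra_simps)
  moreover have "e \<bullet> w \<le> norm e * norm w" "bb \<bullet> w \<le> norm bb * norm w"
    "(G k *v w) \<bullet> e \<le> norm (G k *v w) * norm e" "(- bb) \<bullet> e \<le> norm bb * norm e"
    using norm_cauchy_schwarz[of "- bb" e] by (simp_all add: norm_cauchy_schwarz)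
  moreover have "0 \<le> e \<bullet> e" by simp
  ultimately have "mu k * (norm w)\<^sup>2
      \<le> norm e * norm w + norm bb * norm w + norm (G k *v w) * norm e + norm bb * norm e"
    using G_lower[of k w] by linarith
  then show ?thesis unfolding e_def[symmetric] w_def[symmetric] by (simp add: distrib_right)
qed

text \<open>Everything needed about a single step, with constants chosen before \<open>k\<close>.
  The last conjunct makes closeness to \<open>xstar\<close> imply a small residual.\<close>

lemma local_step:
  assumes pos: "\<And>j. 0 < r j"
    and xs: "xstar \<in> strongly_stationary_points" and eps: "0 < \<epsilon>" and L: "0 < L"
    and lip: "\<And>u v. u \<in> cball xstar \<epsilon> \<inter> effdom \<phi> \<Longrightarrow> v \<in> cball xstar \<epsilon> \<inter> effdom \<phi> \<Longrightarrow>
          spectral_norm (hess_psi_at u - hess_psi_at v) \<le> L * norm (A *v u - A *v v)"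
    and beta: "0 < \<beta>" and qe: "max \<delta> (1 - \<delta>) < qe"
    and error_bound: "\<And>u. u \<in> cball xstar \<epsilon> \<inter> effdom \<phi> \<Longrightarrow>
          \<beta> * infdist u strongly_stationary_points \<le> norm (residual u) powr qe"
  obtains e1 C where "0 < e1" "0 < C"
    and "\<And>k. k \<in> reset_indices \<Longrightarrow> norm (x k - xstar) \<le> e1 \<Longrightarrow>
      \<not> unsuccessful k \<and> norm (d k) \<le> C * r k powr qe
      \<and> norm (residual (xhat k)) \<le> C * r k powr (min (1 + \<tau>) (\<delta> + qe))
      \<and> r k \<le> C * norm (x k - xstar)"
proof -
  let ?N = "cball xstar \<epsilon> \<inter> effdom \<phi>" and ?X = strongly_stationary_points
  have sX: "stationary y" "psd (hess_psi_at y)" "y \<in> effdom \<phi>" if "y \<in> ?X" for y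
    using that by (auto simp: strongly_stationary_points_def stationary_def)
  have xN: "xstar \<in> ?N" using sX[OF xs] eps by simp
  obtain C where C: "1 \<le> C"
    and CA: "\<And>w. norm (transpose A *v (A *v w)) \<le> C * norm w"
    and CH: "\<And>u w. u \<in> ?N \<Longrightarrow> norm (hess_f u *v w) \<le> C * norm w"
    and T1: "\<And>u v. u \<in> ?N \<Longrightarrow> v \<in> ?N \<Longrightarrow>
          norm (grad_f v - grad_f u - hess_f u *v (v - u)) \<le> C * (norm (v - u))\<^sup>2"
    and T2: "\<And>u v. u \<in> ?N \<Longrightarrow> v \<in> ?N \<Longrightarrow>
          \<bar>rf v - rf u - grad_f u \<bullet> (v - u) - (v - u) \<bullet> (hess_f u *v (v - u)) / 2\<bar>
            \<le> C * (norm (v - u)) ^ 3"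
    and CG0: "\<And>u v. u \<in> ?N \<Longrightarrow> v \<in> ?N \<Longrightarrow> norm (grad_f u - grad_f v) \<le> C * norm (u - v)"
    and Clam: "\<And>u v. u \<in> ?N \<Longrightarrow> v \<in> ?N \<Longrightarrow>
          psd (hess_psi_at v) \<Longrightarrow> max 0 (- lambda_min (hess_psi_at u)) \<le> C * norm (u - v)"
    by (rule local_bounds[OF sX(3)[OF xs] eps L lip]) (assumption | rule that)+
  have nm: "0 < \<nu>min" "0 < \<nu>max" using nu_bounds by auto
  have a0: "0 < a" using a by simp
  \<comment> \<open>The factor 2 makes the distance bound strict, so some point of \<open>?X\<close>
    satisfies it even if the infimum is not attained.\<close>
  define b0 where "b0 = 2 / \<beta>"
  have b0: "0 < b0" using beta by (simp add: b0_def)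
  \<comment> \<open>Bounds \<open>G k\<close>: the Hessian, the \<open>Lambda k\<close> term with
    \<open>S \<le> \<epsilon>\<close>, and \<open>mu k\<close> at most
    \<open>\<nu>max\<close>.\<close>
  define CG where "CG = C + a * C * \<epsilon> * C + \<nu>max"
  have CG: "0 < CG" using C a0 eps nm by (simp add: CG_def add_pos_pos)
  \<comment> \<open>The first summand accounts for the model residual, the other two for
    \<open>bb\<close>. Next, \<open>K3\<close> bounds the step by \<open>S\<close>,
    \<open>K4\<close> by \<open>t powr qe\<close>, and \<open>K5\<close> bounds the new residual,
    its summand 1 being reserved for the model residual.\<close>
  define K1 where "K1 = (1 + CG) * (2 + C) / \<nu>min + (C + a * C * C) * b0 / \<nu>min + 1"
  have K1: "0 < K1" using C CG b0 nm a0 by (simp add: K1_def add_pos_pos)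
  define K3 where "K3 = K1 + (2 + C) + 1"
  have K3: "0 < K3" using K1 C by (simp add: K3_def)
  define K4 where "K4 = K3 * b0"
  have K4: "0 < K4" using K3 b0 by (simp add: K4_def)
  define K5 where "K5 = 1 + C * (K4 * K4) + a * C * b0 * C * K4 + \<nu>max * K4"
  have K5: "0 < K5" using C K4 a0 b0 nm by (simp add: K5_def add_pos_pos)
  have qd: "0 < qe - \<delta>" "0 < qe" using qe delta by auto
  \<comment> \<open>In order: powers of \<open>t\<close> decrease in the exponent;
    \<open>xbar\<close> and \<open>xhat k\<close> lie in the \<open>\<epsilon>\<close>-ball; the
    \<open>pred\<close> test is passed, using \<open>1 + \<delta> < \<kappa>\<close>; the ratio test
    is passed, using \<open>\<delta> < qe\<close>.\<close>
  have "eventually (\<lambda>t::real. t < 1 \<and> b0 * t powr qe < \<epsilon> / 2 \<and> K4 * t powr qe < \<epsilon> / 2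
      \<and> 1 * t powr (\<kappa> - 1 - \<delta>) < \<nu>min / (2 * (2 + CG))
      \<and> (C * K4) * t powr (qe - \<delta>) < (1 - c\<^sub>1) * \<nu>min / 2) (at_right 0)"
    using qd kappa eps nm CG c_bounds
    by (intro eventually_conj eventually_mult_powr_less order_tendstoD(2)[OF tendsto_ident_at]) auto
  then obtain t0 where t0: "0 < t0" and small: "\<And>t. 0 < t \<Longrightarrow> t < t0 \<Longrightarrow>
      t < 1 \<and> b0 * t powr qe < \<epsilon> / 2 \<and> K4 * t powr qe < \<epsilon> / 2
      \<and> t powr (\<kappa> - 1 - \<delta>) < \<nu>min / (2 * (2 + CG))
      \<and> (C * K4) * t powr (qe - \<delta>) < (1 - c\<^sub>1) * \<nu>min / 2"
    unfolding eventually_at_right_field by auto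
  \<comment> \<open>The first entry leaves half the radius for reaching \<open>xbar\<close> and
    \<open>xhat k\<close>; the second forces \<open>r k < t0\<close>.\<close>
  define e1 where "e1 = min (\<epsilon> / 2) (t0 / (2 * (2 + C)))"
  have e1: "0 < e1" using eps t0 C by (simp add: e1_def)
  have res_lip: "norm (residual u) \<le> (2 + C) * norm (u - v)" if "u \<in> ?N" "v \<in> ?N" "stationary v" for u v
    using residual_difference[of u v] CG0[OF that(1,2)] residual_stationary[OF that(3)]
    by (simp add: algebra_simps)
  have main: "\<not> unsuccessful k \<and> norm (d k) \<le> K4 * r k powr qe
      \<and> norm (residual (xhat k)) \<le> K5 * r k powr (min (1 + \<tau>) (\<delta> + qe))
      \<and> r k \<le> (2 + C) * norm (x k - xstar)"
    if kK: "k \<in> reset_indices" and near: "norm (x k - xstar) \<le> e1" for k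
  proof -
    define t where "t = r k"
    have t: "0 < t" using pos by (simp add: t_def)
    have near_eps: "norm (x k - xstar) \<le> \<epsilon> / 2" using near by (simp add: e1_def)
    have xkN: "x k \<in> ?N"
      using near_eps eps iterate_effdom by (simp add: dist_norm norm_minus_commute)
    have rk: "t \<le> (2 + C) * norm (x k - xstar)"
      using res_lip[OF xkN xN sX(1)[OF xs]] by (simp add: t_def r_def)
    also have "\<dots> \<le> (2 + C) * (t0 / (2 * (2 + C)))"
      using near C by (intro mult_left_mono) (auto simp: e1_def)
    also have "\<dots> = t0 / 2" using C by (simp add: field_simps)
    also have "\<dots> < t0" using t0 by simp
    finally have tt0: "t < t0" .
    note sm = small[OF t tt0]
    have t1: "t < 1" using sm by simp
    have powr_mono: "t powr p \<le> t powr p'" if "p' \<le> p" for p p'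
      using t t1 that by (intro powr_mono') auto
    define mk where "mk = mu k"
    have rb: "rbar k = t" using rbar_reset[OF kK] by (simp add: t_def)
    have mk: "mk = \<nu> k * t powr \<delta>" by (simp add: mk_def mu_def rb)
    have td: "0 < t powr \<delta>" using t by simp
    have mlo: "\<nu>min * t powr \<delta> \<le> mk" unfolding mk using nu_lower td by (intro mult_right_mono) auto
    have mhi: "mk \<le> \<nu>max * t powr \<delta>"
      unfolding mk using nu_upper_reset[OF kK pos] td by (intro mult_right_mono) auto
    have m0: "0 < mk" using mlo nm td by (meson less_le_trans mult_pos_pos)
    have "t powr \<delta> \<le> 1" using powr_mono[of 0 \<delta>] delta t by simp
    then have "\<nu>max * t powr \<delta> \<le> \<nu>max * 1" using nm by (intro mult_left_mono) auto
    then have m1: "mk \<le> \<nu>max" using mhi by simp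
    have tdm: "t powr \<delta> \<le> mk / \<nu>min" using mlo nm by (simp add: field_simps)
    have "infdist (x k) ?X < b0 * t powr qe"
    proof -
      have "\<beta> * infdist (x k) ?X \<le> t powr qe" using error_bound[OF xkN] by (simp add: t_def r_def)
      also have "\<dots> < 2 * t powr qe" using t by simp
      finally show ?thesis using beta by (simp add: b0_def field_simps)
    qed
    then obtain xbar where xbar: "xbar \<in> ?X" "dist (x k) xbar < b0 * t powr qe"
      using cInf_lessD[of "dist (x k) ` ?X"] xs by (auto simp: infdist_def split: if_splits)
    define s where "s = x k - xbar"
    define S where "S = norm s"
    have S0: "0 \<le> S" by (simp add: S_def)
    have Sq: "S < b0 * t powr qe" using xbar by (simp add: S_def s_def dist_norm)
    have Seps: "S \<le> \<epsilon> / 2" using Sq sm by simp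
    have xbN: "xbar \<in> ?N"
    proof -
      have "norm (xbar - xstar) \<le> norm (x k - xstar) + S"
        unfolding S_def s_def by (metis norm_minus_commute norm_triangle_sub add.commute
            diff_diff_eq2 diff_add_cancel norm_triangle_ineq4 diff_diff_add)
      then show ?thesis using near_eps Seps sX(3)[OF xbar(1)]
        by (simp add: dist_norm norm_minus_commute)
    qed
    have tS: "t \<le> (2 + C) * S"
      using res_lip[OF xkN xbN sX(1)[OF xbar(1)]] by (simp add: t_def r_def S_def s_def)
    have lamS: "Lambda k \<le> a * C * S"
    proof -
      have "Lambda k \<le> a * (C * norm (x k - xbar))" unfolding Lambda_def
        using Clam[OF xkN xbN sX(2)[OF xbar(1)]] a0 by (intro mult_left_mono) auto
      then show ?thesis by (simp add: S_def s_def)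
    qed
    have Glam: "norm (Lambda k *\<^sub>R (transpose A *v (A *v w))) \<le> a * C * S * (C * norm w)" for w
    proof -
      have "norm (Lambda k *\<^sub>R (transpose A *v (A *v w))) = Lambda k * norm (transpose A *v (A *v w))"
        using Lambda_nonneg[of k] by simp
      also have "\<dots> \<le> (a * C * S) * (C * norm w)"
        using lamS CA Lambda_nonneg C a0 S0 by (intro mult_mono) auto
      finally show ?thesis .
    qed
    have Gnorm: "norm (G k *v w) \<le> CG * norm w" for w
    proof -
      have "norm (G k *v w) \<le> norm (hess_f (x k) *v w)
          + norm (Lambda k *\<^sub>R (transpose A *v (A *v w))) + norm (mu k *\<^sub>R w)"
        unfolding G_apply by (metis (no_types) norm_triangle_ineq norm_triangle_mono order_refl)
      also have "\<dots> \<le> C * norm w + a * C * \<epsilon> * (C * norm w) + \<nu>max * norm w"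
      proof (intro add_mono)
        show "norm (hess_f (x k) *v w) \<le> C * norm w" by (rule CH[OF xkN])
        have "a * C * S * (C * norm w) \<le> a * C * \<epsilon> * (C * norm w)"
          using a0 C Seps eps by (intro mult_right_mono mult_left_mono) auto
        then show "norm (Lambda k *\<^sub>R (transpose A *v (A *v w))) \<le> a * C * \<epsilon> * (C * norm w)"
          using Glam[of w] by linarith
        show "norm (mu k *\<^sub>R w) \<le> \<nu>max * norm w"
          using m0 m1 by (simp add: mk_def[symmetric] mult_right_mono)
      qed
      finally show ?thesis by (simp add: CG_def algebra_simps)
    qed
    define e where "e = norm (R k (xhat k))"
    have e0: "0 \<le> e" by (simp add: e_def)
    have e_t: "e \<le> \<theta> * t" "e \<le> \<theta> * t powr (1 + \<tau>)"
      using inexact_residual[of k] theta unfolding e_def t_def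
      by (meson min.cobounded1 min.cobounded2 mult_left_mono order_trans less_imp_le)+
    have e_tau: "e \<le> t powr (1 + \<tau>)"
      using theta by (intro order_trans[OF e_t(2)] mult_left_le_one_le) auto
    have "e \<le> t" using theta t by (intro order_trans[OF e_t(1)] mult_left_le_one_le) auto
    then have eS: "e \<le> (2 + C) * S" using tS by linarith
    \<comment> \<open>Uses \<open>\<delta> \<le> \<tau>\<close>: one factor
      \<open>t powr \<delta>\<close> goes into \<open>mk\<close>, the remaining \<open>t\<close>
      into \<open>S\<close>.\<close>
    have e_mu: "e \<le> mk / \<nu>min * ((2 + C) * S)"
    proof -
      have "e \<le> t powr (1 + \<delta>)" using e_tau powr_mono[of "1 + \<delta>" "1 + \<tau>"] tau by linarith
      also have "\<dots> = t powr \<delta> * t" using t by (simp add: powr_add)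
      also have "\<dots> \<le> mk / \<nu>min * ((2 + C) * S)" using tdm tS t m0 nm by (intro mult_mono) auto
      finally show ?thesis .
    qed
    define bb where "bb = (grad_f xbar - grad_f (x k) - hess_f (x k) *v (xbar - x k))
      + Lambda k *\<^sub>R (transpose A *v (A *v (x k - xbar))) + mu k *\<^sub>R (x k - xbar)"
    \<comment> \<open>Since \<open>\<delta> < qe\<close>, one factor \<open>S\<close> is at most a
      multiple of \<open>mk\<close>, so the terms quadratic in \<open>S\<close> become multiples of
      \<open>mk * S\<close>.\<close>
    have SS: "S * S \<le> b0 * (mk / \<nu>min) * S"
    proof -
      have "t powr qe \<le> mk / \<nu>min" using powr_mono[of \<delta> qe] qd tdm by linarith
      then have "b0 * t powr qe \<le> b0 * (mk / \<nu>min)" using b0 by (intro mult_left_mono) auto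
      then show ?thesis using Sq S0 by (intro mult_right_mono) auto
    qed
    have bb: "norm bb \<le> mk * ((C + a * C * C) * b0 / \<nu>min + 1) * S"
    proof -
      have "norm bb \<le> norm (grad_f xbar - grad_f (x k) - hess_f (x k) *v (xbar - x k))
          + norm (Lambda k *\<^sub>R (transpose A *v (A *v (x k - xbar)))) + norm (mu k *\<^sub>R (x k - xbar))"
        unfolding bb_def by (metis (no_types) norm_triangle_ineq norm_triangle_mono order_refl)
      also have "\<dots> \<le> C * (S * S) + a * C * S * (C * S) + mk * S"
        using T1[OF xkN xbN] Glam[of "x k - xbar"] m0
        by (intro add_mono) (auto simp: S_def s_def mk_def power2_eq_square norm_minus_commute)
      also have "\<dots> = (C + a * C * C) * (S * S) + mk * S" by (simp add: algebra_simps)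
      also have "\<dots> \<le> (C + a * C * C) * (b0 * (mk / \<nu>min) * S) + mk * S"
        using SS C a0 by (intro add_right_mono mult_left_mono) auto
      finally show ?thesis by (simp add: algebra_simps)
    qed
    define W where "W = norm (xhat k - xbar)"
    have W0: "0 \<le> W" by (simp add: W_def)
    have lin: "(1 + CG) * e + norm bb \<le> mk * K1 * S"
    proof -
      have "(1 + CG) * e \<le> (1 + CG) * (mk / \<nu>min * ((2 + C) * S))"
        using e_mu CG by (intro mult_left_mono) auto
      then show ?thesis using bb by (simp add: K1_def algebra_simps add_divide_distrib)
    qed
    have "mk * (W * W) \<le> (e + norm bb) * W + (CG * W + norm bb) * e"
    proof -
      have "mk * W\<^sup>2 \<le> (e + norm bb) * W + (norm (G k *v (xhat k - xbar)) + norm bb) * e"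
        using displacement_inequality[OF sX(1)[OF xbar(1)], of k]
        by (simp only: bb_def W_def e_def mk_def)
      moreover have "(norm (G k *v (xhat k - xbar)) + norm bb) * e \<le> (CG * W + norm bb) * e"
        using Gnorm[of "xhat k - xbar"] e0 by (intro mult_right_mono) (auto simp: W_def)
      ultimately show ?thesis by (simp add: power2_eq_square)
    qed
    also have "\<dots> = ((1 + CG) * e + norm bb) * W + norm bb * e" by (simp add: algebra_simps)
    \<comment> \<open>Every term now carries the factor \<open>mk\<close>, which cancels; the bound
      on \<open>W\<close> does not degrade as the regularization vanishes.\<close>
    also have "\<dots> \<le> (mk * K1 * S) * W + (mk * K1 * S) * ((2 + C) * S)"
    proof (intro add_mono mult_mono lin eS)
      show "norm bb \<le> mk * K1 * S" using lin CG e0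
        by (smt (verit) mult_nonneg_nonneg)
    qed (use W0 m0 K1 S0 e0 in auto)
    also have "\<dots> = mk * (K1 * S * W + K1 * (2 + C) * (S * S))" by (simp add: algebra_simps)
    finally have "W * W \<le> K1 * S * W + K1 * (2 + C) * (S * S)" using m0 by simp
    then have WS: "W \<le> (K1 + (2 + C)) * S"
      by (rule quadratic_inequality_bound) (use W0 S0 K1 C in auto)
    define D where "D = norm (d k)"
    have D0: "0 \<le> D" by (simp add: D_def)
    have "D \<le> W + S"
    proof -
      have "d k = (xhat k - xbar) - s" by (simp add: d_def s_def)
      then show ?thesis unfolding D_def W_def S_def by (metis norm_triangle_ineq4)
    qed
    then have DS: "D \<le> K3 * S" using WS by (simp add: K3_def algebra_simps)
    also have "\<dots> \<le> K3 * (b0 * t powr qe)" using Sq K3 by (intro mult_left_mono) auto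
    finally have Dq: "D \<le> K4 * t powr qe" by (simp add: K4_def mult.assoc)
    have xhN: "xhat k \<in> ?N"
    proof -
      have "xhat k - xstar = (x k - xstar) + d k" by (simp add: d_def)
      then have "norm (xhat k - xstar) \<le> norm (x k - xstar) + D"
        unfolding D_def by (metis norm_triangle_ineq)
      then show ?thesis using near_eps Dq sm xhat_effdom by (simp add: dist_norm norm_minus_commute)
    qed
    have resh: "norm (residual (xhat k)) \<le> K5 * t powr (min (1 + \<tau>) (\<delta> + qe))"
    proof -
      let ?p = "min (1 + \<tau>) (\<delta> + qe)"
      let ?E = "grad_f (xhat k) - grad_f (x k) - hess_f (x k) *v d k"
      have eq: "grad_f (xhat k) - grad_f (x k) - G k *v d k
          = ?E - Lambda k *\<^sub>R (transpose A *v (A *v d k)) - mu k *\<^sub>R d k"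
        by (simp add: G_apply)
      have "norm (grad_f (xhat k) - grad_f (x k) - G k *v d k)
          \<le> norm ?E + norm (Lambda k *\<^sub>R (transpose A *v (A *v d k))) + norm (mu k *\<^sub>R d k)"
        unfolding eq using norm_triangle_ineq4[of ?E "Lambda k *\<^sub>R (transpose A *v (A *v d k))"]
          norm_triangle_ineq4[of "?E - Lambda k *\<^sub>R (transpose A *v (A *v d k))" "mu k *\<^sub>R d k"]
        by linarith
      also have "\<dots> \<le> C * (D * D) + a * C * S * (C * D) + mk * D"
        using T1[OF xkN xhN] Glam[of "d k"] m0
        by (intro add_mono) (auto simp: D_def d_def mk_def power2_eq_square)
      also have "\<dots> \<le> C * (K4 * t powr qe * (K4 * t powr qe))
          + a * C * (b0 * t powr qe) * (C * (K4 * t powr qe)) + \<nu>max * t powr \<delta> * (K4 * t powr qe)"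
        using Dq D0 C a0 Sq S0 mhi m0 nm td K4 by (intro add_mono mult_mono mult_left_mono) auto
      also have "\<dots> = (C * (K4 * K4) + a * C * b0 * C * K4) * t powr (qe + qe)
          + \<nu>max * K4 * t powr (\<delta> + qe)"
        unfolding powr_add by (simp add: algebra_simps)
      \<comment> \<open>As \<open>\<delta> < qe\<close>, the exponent \<open>qe + qe\<close> exceeds
        \<open>\<delta> + qe\<close>, and lowering an exponent enlarges a power of
        \<open>t < 1\<close>.\<close>
      also have "\<dots> \<le> (C * (K4 * K4) + a * C * b0 * C * K4) * t powr ?p + \<nu>max * K4 * t powr ?p"
        using C K4 a0 b0 nm qd by (intro add_mono mult_left_mono powr_mono) auto
      finally have "norm (grad_f (xhat k) - grad_f (x k) - G k *v d k)
          \<le> (K5 - 1) * t powr ?p" by (simp add: K5_def algebra_simps)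
      moreover have "norm (residual (xhat k) - R k (xhat k))
          \<le> norm (grad_f (xhat k) - grad_f (x k) - G k *v d k)"
        unfolding R_def d_def by (rule residual_model_residual)
      moreover have "norm (residual (xhat k)) \<le> norm (R k (xhat k)) + norm (residual (xhat k) - R k (xhat k))"
        by (rule norm_triangle_sub)
      moreover have "e \<le> t powr ?p" using e_tau powr_mono[of ?p "1 + \<tau>"] by simp
      ultimately show ?thesis by (simp add: e_def algebra_simps)
    qed
    \<comment> \<open>The model residual equals \<open>t\<close> in norm at \<open>x k\<close> and
      is at most \<open>\<theta> * t\<close> at the trial point; so large a drop requires a step of
      comparable length.\<close>
    have Dlow: "(1 - \<theta>) * t \<le> (2 + CG) * D"
    proof -
      have "norm (residual (x k)) \<le> norm (R k (xhat k)) + norm (residual (x k) - R k (xhat k))"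
        by (rule norm_triangle_sub)
      moreover have "norm (residual (x k) - R k (xhat k)) \<le> 2 * D + norm (G k *v d k)"
        using model_residual_difference[of "G k" "x k" "xhat k" "x k"]
          residual_eq_model_residual[of "x k" "G k"]
        by (simp add: R_def D_def d_def norm_minus_commute)
      ultimately show ?thesis using Gnorm[of "d k"] e_t(1) unfolding e_def t_def r_def D_def[symmetric]
        by (simp add: algebra_simps)
    qed
    have th: "0 < 1 - \<theta>" using theta by simp
    have Dpos: "0 < D"
    proof -
      have "0 < (1 - \<theta>) * t" using th t by simp
      then have "0 < (2 + CG) * D" using Dlow by linarith
      then show ?thesis using CG by (simp add: zero_less_mult_iff)
    qed
    define pk where "pk = ph (x k) - ph (xhat k) - grad_f (x k) \<bullet> d k - d k \<bullet> (hess_f (x k) *v d k) / 2"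
    have pk: "pred k = ereal pk" by (simp add: pred_eq pk_def)
    have plow: "mk / 2 * (D * D) \<le> pk"
      using pred_lower[of k] m0 by (simp add: pk_def mk_def D_def power2_eq_square)
    have ppos: "0 < pk"
    proof -
      have "0 < mk / 2 * (D * D)" using m0 Dpos by simp
      then show ?thesis using plow by linarith
    qed
    define ak where "ak = rf (x k) + ph (x k) - rf (xhat k) - ph (xhat k)"
    have ak: "ared k = ereal ak" by (simp add: ared_eq ak_def)
    \<comment> \<open>Of the two factors \<open>D\<close> in \<open>plow\<close>, one is kept and
      the other replaced by \<open>Dlow\<close>; the surplus power
      \<open>\<kappa> - 1 - \<delta>\<close> of \<open>t\<close> absorbs the constants.\<close>
    have first: "pmin * (1 - \<theta>) * D * min t (t powr \<kappa>) < pk"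
    proof -
      have "t powr \<kappa> = t powr (\<kappa> - 1 - \<delta>) * (t powr \<delta> * t)"
        using t powr_add[of t "\<kappa> - 1 - \<delta>" "\<delta> + 1"] by (simp add: powr_add)
      also have "\<dots> < \<nu>min / (2 * (2 + CG)) * (t powr \<delta> * t)"
        using sm td t by (intro mult_strict_right_mono) auto
      finally have tk: "t powr \<kappa> < \<nu>min / (2 * (2 + CG)) * (t powr \<delta> * t)" .
      have "pmin * (1 - \<theta>) * D * min t (t powr \<kappa>) \<le> 1 * (1 - \<theta>) * D * t powr \<kappa>"
        using pmin th Dpos t by (intro mult_mono) auto
      also have "\<dots> = D * ((1 - \<theta>) * t powr \<kappa>)" by simp
      also have "\<dots> < D * ((1 - \<theta>) * (\<nu>min / (2 * (2 + CG)) * (t powr \<delta> * t)))"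
        using tk th Dpos by (intro mult_strict_left_mono) auto
      also have "\<dots> = D * (\<nu>min * t powr \<delta> / 2 * ((1 - \<theta>) * t / (2 + CG)))"
        using CG by (simp add: field_simps)
      also have "\<dots> \<le> D * (mk / 2 * D)"
      proof (intro mult_left_mono mult_mono)
        show "(1 - \<theta>) * t / (2 + CG) \<le> D" using Dlow CG by (simp add: field_simps)
      qed (use mlo D0 m0 th t CG in auto)
      also have "\<dots> \<le> pk" using plow by (simp add: algebra_simps)
      finally show ?thesis .
    qed
    \<comment> \<open>\<open>pk - ak\<close> is the second-order Taylor error, at most
      \<open>C * D ^ 3\<close>; since \<open>D\<close> is small relative to \<open>mk\<close>, this
      is below \<open>(1 - c\<^sub>1) * pk\<close>.\<close>
    have second: "c\<^sub>1 * pk < ak"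
    proof -
      have "ak = pk - (rf (xhat k) - rf (x k) - grad_f (x k) \<bullet> d k - d k \<bullet> (hess_f (x k) *v d k) / 2)"
        by (simp add: ak_def pk_def)
      then have "pk - C * D ^ 3 \<le> ak" using T2[OF xkN xhN] by (simp add: d_def[symmetric] D_def)
      moreover have "C * D ^ 3 < (1 - c\<^sub>1) * pk"
      proof -
        have "C * D \<le> C * (K4 * t powr qe)" using Dq C by (intro mult_left_mono) auto
        also have "\<dots> = (C * K4) * t powr (qe - \<delta>) * t powr \<delta>"
          using powr_add[of t "qe - \<delta>" \<delta>] by (simp add: mult.assoc)
        also have "\<dots> < (1 - c\<^sub>1) * \<nu>min / 2 * t powr \<delta>"
          using sm td by (intro mult_strict_right_mono) auto
        also have "\<dots> \<le> (1 - c\<^sub>1) * (mk / 2)"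
          using mult_left_mono[OF mlo, of "(1 - c\<^sub>1) / 2"] c_bounds by (simp add: algebra_simps)
        finally have "C * D * (D * D) < (1 - c\<^sub>1) * (mk / 2) * (D * D)"
          using Dpos by (intro mult_strict_right_mono) auto
        also have "\<dots> \<le> (1 - c\<^sub>1) * pk"
          using mult_left_mono[OF plow, of "1 - c\<^sub>1"] c_bounds by (simp add: mult.assoc)
        finally show ?thesis by (simp add: power3_eq_cube mult.assoc)
      qed
      ultimately show ?thesis by (simp add: algebra_simps)
    qed
    have "rho k = ereal (ak / pk)" using ppos by (simp add: rho_def ak pk)
    then have "\<not> rho k \<le> ereal c\<^sub>1" using second ppos by (simp add: field_simps not_le)
    then have "\<not> unsuccessful k"
      using first by (simp add: unsuccessful_def pk not_le D_def[symmetric] t_def[symmetric])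
    then show ?thesis using Dq resh rk by (simp add: D_def t_def)
  qed
  define CC where "CC = K4 + K5 + (2 + C)"
  have CC: "K4 \<le> CC" "K5 \<le> CC" "2 + C \<le> CC" "0 < CC" using K4 K5 C by (auto simp: CC_def)
  have up: "X \<le> c * y \<Longrightarrow> c \<le> CC \<Longrightarrow> 0 \<le> y \<Longrightarrow> X \<le> CC * y" for X c y :: real
    by (meson mult_right_mono order_trans)
  show ?thesis
  proof (rule that[OF e1 CC(4)])
    fix k assume "k \<in> reset_indices" "norm (x k - xstar) \<le> e1"
    from main[OF this] show "\<not> unsuccessful k \<and> norm (d k) \<le> CC * r k powr qe
      \<and> norm (residual (xhat k)) \<le> CC * r k powr (min (1 + \<tau>) (\<delta> + qe))
      \<and> r k \<le> CC * norm (x k - xstar)"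
      using up[OF _ CC(1)] up[OF _ CC(2)] up[OF _ CC(3)] by simp
  qed
qed

section \<open>From one step to the whole sequence\<close>

text \<open>From a reset index close enough to \<open>xstar\<close> the one-step estimates reproduce
  themselves: residuals shrink geometrically, so the total path length is controlled by the first
  residual.\<close>

lemma local_convergence:
  assumes pos: "\<And>j. 0 < r j" and pq: "1 < p" "0 < qe"
    and e1: "0 < e1" and C: "0 < C"
    and step: "\<And>k. k \<in> reset_indices \<Longrightarrow> norm (x k - xstar) \<le> e1 \<Longrightarrow>
      \<not> unsuccessful k \<and> norm (d k) \<le> C * r k powr qe
      \<and> norm (residual (xhat k)) \<le> C * r k powr p \<and> r k \<le> C * norm (x k - xstar)"
    and acc: "\<And>e. 0 < e \<Longrightarrow> \<exists>k\<in>reset_indices. norm (x k - xstar) < e"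
  shows "x \<longlonglongrightarrow> xstar" and "r \<longlonglongrightarrow> 0"
    and "eventually (\<lambda>k. r (Suc k) \<le> C * r k powr p) sequentially"
proof -
  \<comment> \<open>When residuals contract by \<open>\<eta>\<close>, the step bounds
    \<open>C * r k powr qe\<close> contract by this factor.\<close>
  define \<gamma> where "\<gamma> = \<eta> powr qe"
  have \<gamma>: "0 < \<gamma>" "\<gamma> < 1" using eta pq powr_less_mono2[of qe \<eta> 1] by (auto simp: \<gamma>_def)
  have tail: "\<exists>k0. \<forall>k\<ge>k0. norm (x k - xstar) \<le> e \<and> r k \<le> e \<and> r (Suc k) \<le> C * r k powr p"
    if e: "0 < e" for e
  proof -
    define e2 where "e2 = min e1 e"
    have e2: "0 < e2" using e e1 by (simp add: e2_def)
    \<comment> \<open>The second condition makes the next residual pass the reset test; the third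
      bounds the whole geometric series of step lengths by half of \<open>e2\<close>.\<close>
    have "eventually (\<lambda>t::real. t < e \<and> C * t powr (p - 1) < \<eta>
        \<and> (C / (1 - \<gamma>)) * t powr qe < e2 / 2) (at_right 0)"
      using pq e e2 eta
      by (intro eventually_conj eventually_mult_powr_less order_tendstoD(2)[OF tendsto_ident_at]) auto
    then obtain t0 where t0: "0 < t0" and small: "\<And>t. 0 < t \<Longrightarrow> t < t0 \<Longrightarrow>
        t < e \<and> C * t powr (p - 1) < \<eta> \<and> (C / (1 - \<gamma>)) * t powr qe < e2 / 2"
      unfolding eventually_at_right_field by auto
    define e3 where "e3 = min (e2 / 2) (t0 / C)"
    have "0 < e3" using e2 t0 C by (simp add: e3_def)
    then obtain k0 where k0: "k0 \<in> reset_indices" "norm (x k0 - xstar) < e3" using acc by blast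
    have near0: "norm (x k0 - xstar) < e2 / 2" using k0(2) by (simp add: e3_def)
    have "norm (x k0 - xstar) \<le> e1" using near0 e2 by (simp add: e2_def)
    then have "r k0 \<le> C * norm (x k0 - xstar)" using step[OF k0(1)] by blast
    also have "\<dots> < C * (t0 / C)" using k0(2) C by (intro mult_strict_left_mono) (auto simp: e3_def)
    finally have r0: "r k0 < t0" using C by simp
    define T where "T = r k0 powr qe"
    have T0: "0 < T" using pos[of k0] by (simp add: T_def)
    have T: "C * T / (1 - \<gamma>) < e2 / 2" using small[OF pos r0] by (simp add: T_def)
    \<comment> \<open>Distances are measured from \<open>x k0\<close> by partial sums of the series,
      so the bound on its total keeps the iterates within \<open>e2\<close> of \<open>xstar\<close>
      at every stage.\<close>
    have inv: "k0 + i \<in> reset_indices \<and> r (k0 + i) \<le> \<eta> ^ i * r k0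
        \<and> norm (x (k0 + i) - x k0) \<le> C * T * (\<Sum>j<i. \<gamma> ^ j)
        \<and> r (Suc (k0 + i)) \<le> C * r (k0 + i) powr p \<and> norm (x (k0 + i) - xstar) \<le> e2" for i
    proof (induction i)
      have post: "Suc k \<in> reset_indices \<and> r (Suc k) \<le> \<eta> * r k
          \<and> norm (x (Suc k) - x k) \<le> C * r k powr qe \<and> r (Suc k) \<le> C * r k powr p"
        if k: "k \<in> reset_indices" "norm (x k - xstar) \<le> e2" "r k \<le> r k0" for k
      proof -
        have st: "\<not> unsuccessful k" "norm (d k) \<le> C * r k powr qe"
          "norm (residual (xhat k)) \<le> C * r k powr p"
          using step[OF k(1)] k(2) by (auto simp: e2_def)
        have xs: "x (Suc k) = xhat k"
          using successful_step[OF st(1)] highly_successful_step[OF st(1)] by (meson not_le)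
        have rp: "r (Suc k) \<le> C * r k powr p" using st(3) by (simp add: r_def xs)
        also have "\<dots> = C * r k powr (p - 1) * r k"
          using pos[of k] powr_add[of "r k" "p - 1" 1] by simp
        also have "\<dots> \<le> \<eta> * r k"
          using small[of "r k"] pos[of k] k(3) r0 by (intro mult_right_mono) auto
        finally have re: "r (Suc k) \<le> \<eta> * r k" .
        then have "Suc k \<in> reset_indices"
          using rbar_reset[OF k(1)] by (auto simp: reset_indices_def r_def)
        then show ?thesis using re rp st(2) by (simp add: xs d_def)
      qed
      {
        case 0
        have "norm (x k0 - xstar) \<le> e2" using near0 e2 by simp
        then show ?case using k0(1) post[of k0] by simp
      next
        case (Suc i)
        let ?k = "k0 + i"
        have "\<eta> ^ i * r k0 \<le> r k0"
          using eta pos[of k0] by (intro mult_left_le_one_le) (auto simp: power_le_one)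
        then have rk: "r ?k \<le> r k0" using Suc by linarith
        have P: "Suc ?k \<in> reset_indices" "r (Suc ?k) \<le> \<eta> * r ?k"
          "norm (x (Suc ?k) - x ?k) \<le> C * r ?k powr qe"
          using post[of ?k] Suc rk by auto
        have r1: "r (Suc ?k) \<le> \<eta> ^ Suc i * r k0"
        proof -
          have "\<eta> * r ?k \<le> \<eta> * (\<eta> ^ i * r k0)" using Suc eta by (intro mult_left_mono) auto
          then show ?thesis using P(2) by (simp add: mult.assoc)
        qed
        have "r ?k powr qe \<le> (\<eta> ^ i * r k0) powr qe"
          using Suc pos[of ?k] pq by (intro powr_mono2) auto
        also have "\<dots> = \<gamma> ^ i * T"
          using eta pos[of k0] unfolding \<gamma>_def T_def
          by (simp add: powr_mult powr_realpow[symmetric] powr_powr mult.commute)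
        finally have "C * r ?k powr qe \<le> C * (\<gamma> ^ i * T)" using C by (intro mult_left_mono) auto
        then have dist1: "norm (x (Suc ?k) - x k0) \<le> C * T * (\<Sum>j<Suc i. \<gamma> ^ j)"
          using P(3) Suc norm_triangle_ineq[of "x (Suc ?k) - x ?k" "x ?k - x k0"]
          by (simp add: algebra_simps)
        have "(\<Sum>j<Suc i. \<gamma> ^ j) \<le> 1 / (1 - \<gamma>)"
          using sum_gp_strict[of \<gamma> "Suc i"] \<gamma> by (auto intro!: divide_right_mono)
        then have "C * T * (\<Sum>j<Suc i. \<gamma> ^ j) \<le> C * T * (1 / (1 - \<gamma>))"
          using C T0 by (intro mult_left_mono) auto
        then have "norm (x (Suc ?k) - x k0) < e2 / 2"
          using dist1 T unfolding times_divide_eq_right mult_1_right by linarith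
        then have near: "norm (x (Suc ?k) - xstar) \<le> e2"
          using near0 norm_triangle_ineq[of "x (Suc ?k) - x k0" "x k0 - xstar"] by simp
        have "\<eta> * r ?k \<le> r ?k" using eta pos[of ?k] by (intro mult_left_le_one_le) auto
        then have "r (Suc ?k) \<le> r k0" using P(2) rk by linarith
        then have "r (Suc (Suc ?k)) \<le> C * r (Suc ?k) powr p" using post P(1) near by blast
        then show ?case using P(1) r1 dist1 near by simp
      }
    qed
    have "norm (x k - xstar) \<le> e \<and> r k \<le> e \<and> r (Suc k) \<le> C * r k powr p" if k: "k0 \<le> k" for k
    proof -
      obtain i where i: "k = k0 + i" using k le_Suc_ex by blast
      have "\<eta> ^ i * r k0 \<le> r k0"
        using eta pos[of k0] by (intro mult_left_le_one_le) (auto simp: power_le_one)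
      then show ?thesis using inv[of i] small[OF pos r0] by (simp add: i e2_def)
    qed
    then show ?thesis by blast
  qed
  show "x \<longlonglongrightarrow> xstar"
  proof (rule LIMSEQ_I)
    fix e :: real assume "0 < e"
    then obtain k0 where "\<forall>k\<ge>k0. norm (x k - xstar) \<le> e / 2" using tail[of "e / 2"] by auto
    then show "\<exists>k0. \<forall>k\<ge>k0. norm (x k - xstar) < e" using \<open>0 < e\<close> by (intro exI[of _ k0]) force
  qed
  show "r \<longlonglongrightarrow> 0"
  proof (rule LIMSEQ_I)
    fix e :: real assume "0 < e"
    then obtain k0 where "\<forall>k\<ge>k0. r k \<le> e / 2" using tail[of "e / 2"] by auto
    then show "\<exists>k0. \<forall>k\<ge>k0. norm (r k - 0) < e"
      using \<open>0 < e\<close> pos by (intro exI[of _ k0]) (force simp: abs_of_pos)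
  qed
  show "eventually (\<lambda>k. r (Suc k) \<le> C * r k powr p) sequentially"
    using tail[of 1] by (auto simp: eventually_sequentially)
qed

end

section \<open>Assembly of the local estimates\<close>

theorem theorem18:
  fixes A :: "real ^ 'n ^ 'm" and b :: "real ^ 'm"
    and \<psi> :: "real ^ 'm \<Rightarrow> ereal" and \<phi> :: "real ^ 'n \<Rightarrow> ereal"
    and c\<^sub>1 c\<^sub>2 \<sigma>\<^sub>1 \<sigma>\<^sub>2 \<eta> \<theta> \<alpha> a \<nu>min \<nu>max \<delta> \<tau> pmin \<kappa> :: real
    and x xhat :: "nat \<Rightarrow> real ^ 'n" and \<nu> rbar :: "nat \<Rightarrow> real"
    and xstar :: "real ^ 'n" and Xstar :: "(real ^ 'n) set"
    and \<epsilon> L \<beta> q :: real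
  assumes iterates: "rpn_method A b \<psi> \<phi> c\<^sub>1 c\<^sub>2 \<sigma>\<^sub>1 \<sigma>\<^sub>2 \<eta> \<theta> \<alpha> a \<nu>min \<nu>max \<delta> \<tau> pmin \<kappa> x xhat \<nu> rbar"
    and infinite_run: "\<And>k. composite_data.residual A b \<psi> \<phi> (x k) \<noteq> 0"
    and Xstar: "Xstar = composite_data.strongly_stationary_points A b \<psi> \<phi>"
    and Xstar_nonempty: "Xstar \<noteq> {}"
    and xstar: "xstar \<in> Xstar"
    and accumulation: "\<exists>s. strict_mono s
          \<and> (\<forall>i. s i \<in> rpn_data.reset_indices A b \<psi> \<phi> \<eta> x rbar) \<and> (\<lambda>i. x (s i)) \<longlonglongrightarrow> xstar"
    and eps: "\<epsilon> > 0" and L: "L > 0"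
    and hess_lipschitz: "\<And>u v. u \<in> cball xstar \<epsilon> \<inter> effdom \<phi> \<Longrightarrow> v \<in> cball xstar \<epsilon> \<inter> effdom \<phi> \<Longrightarrow>
          spectral_norm (composite_data.hess_psi_at A b \<psi> u - composite_data.hess_psi_at A b \<psi> v)
            \<le> L * norm (A *v u - A *v v)"
    and beta: "\<beta> > 0" and q: "q > max \<delta> (1 - \<delta>)"
    and error_bound: "\<And>u. u \<in> cball xstar \<epsilon> \<inter> effdom \<phi> \<Longrightarrow>
          \<beta> * infdist u Xstar \<le> norm (composite_data.residual A b \<psi> \<phi> u) powr q"
  shows "x \<longlonglongrightarrow> xstar
    \<and> min (1 + \<tau>) (\<delta> + q) > 1
    \<and> converges_to_0_at_rate (\<lambda>k. norm (composite_data.residual A b \<psi> \<phi> (x k)))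
        (min (1 + \<tau>) (\<delta> + q))"
proof -
  interpret rpn_method A b \<psi> \<phi> c\<^sub>1 c\<^sub>2 \<sigma>\<^sub>1 \<sigma>\<^sub>2 \<eta> \<theta> \<alpha> a \<nu>min \<nu>max \<delta> \<tau> pmin \<kappa> x xhat \<nu> rbar
    by (rule iterates)
  let ?p = "min (1 + \<tau>) (\<delta> + q)"
  have pos: "0 < r j" for j using infinite_run[of j] by (simp add: r_def)
  \<comment> \<open>The lower bound \<open>1 - \<delta>\<close> on \<open>q\<close> makes
    \<open>\<delta> + q\<close> exceed 1; \<open>1 + \<tau>\<close> does because
    \<open>0 < \<delta> \<le> \<tau>\<close>.\<close>
  have p: "1 < ?p" "0 < q" using q delta tau by auto
  obtain e1 C where e1: "0 < e1" and C: "0 < C"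
    and step: "\<And>k. k \<in> reset_indices \<Longrightarrow> norm (x k - xstar) \<le> e1 \<Longrightarrow>
      \<not> unsuccessful k \<and> norm (d k) \<le> C * r k powr q
      \<and> norm (residual (xhat k)) \<le> C * r k powr ?p \<and> r k \<le> C * norm (x k - xstar)"
    by (rule local_step[OF pos xstar[unfolded Xstar] eps L hess_lipschitz beta q
          error_bound[unfolded Xstar]]) (assumption | rule that)+
  have acc: "\<exists>k\<in>reset_indices. norm (x k - xstar) < e" if "0 < e" for e
  proof -
    obtain s where s: "\<And>i. s i \<in> reset_indices" "(\<lambda>i. x (s i)) \<longlonglongrightarrow> xstar"
      using accumulation by blast
    from LIMSEQ_D[OF s(2) that] s(1) show ?thesis by blast
  qed
  note conv = local_convergence[OF pos p e1 C step acc]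
  have "(\<lambda>k. norm (residual (x k))) = r" by (simp add: r_def fun_eq_iff)
  moreover have "converges_to_0_at_rate r ?p"
    using conv(2,3) C unfolding converges_to_0_at_rate_def by blast
  ultimately show ?thesis using conv(1) p(1) by simp
qed

end
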